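(* Let $\xi$ be a $\mathbb{Z}_{\geq 0}$-valued random variable with $\mathbb{E}[\xi] = 1$ and $0 < \sigma^2 := \mathrm{Var}[\xi] < \infty$. Let $\mathcal{T}$ be a Galton-Watson tree with offspring distribution $\xi$, and for $n \geq 1$ let $T_n$ be $\mathcal{T}$ conditioned to have exactly $n$ vertices. For any $\epsilon = \epsilon(n)$ tending to $0$ as $n \to \infty$, we have $$\Pr\Big( (\epsilon n)^{1/3} \le b(T_n) \le (n/\epsilon)^{1/3} \Big) = 1 - O(\epsilon).$$
   Context: Graph burning: vertices are burning or unburned; in each discrete round, every burning vertex causes all its neighbours to burn, and a new fire source (a previously unburned vertex) is chosen and set burning. The burning number $b(G)$ of a graph $G$ is the minimum number of rounds needed for all vertices to burn. Equivalently, writing $B_r(v) = \{u : d(u,v) \le r\}$ for the ball of radius $r$ around $v$ in the graph distance $d$, $b(G) = \min\{k \in \mathbb{N} : \exists v_0,\dots,v_{k-1} \in V(G) \text{ with } \bigcup_{r=0}^{k-1} B_r(v_r) = V(G)\}$. The asymptotics are over $n$ for which $\Pr(|\mathcal{T}| = n) > 0$, so that the conditioning is well defined. *)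

theory Defs
  imports "HOL-Probability.Probability" "HOL-Library.Landau_Symbols"
begin

text \<open>
  A graph is given by its vertex set \<open>V\<close> and its symmetric adjacency relation
  \<open>E \<subseteq> V \<times> V\<close>; a walk of length \<open>k\<close> from \<open>u\<close> to \<open>v\<close> is then an instance of
  \<open>(u, v) \<in> E ^^ k\<close>. The distance between different components is \<open>\<infinity>\<close>.
\<close>

definition graph_dist :: "('a \<times> 'a) set \<Rightarrow> 'a \<Rightarrow> 'a \<Rightarrow> enat" where
  "graph_dist E u v = (INF k \<in> {k. (u, v) \<in> E ^^ k}. enat k)"

definition graph_ball :: "'a set \<Rightarrow> ('a \<times> 'a) set \<Rightarrow> nat \<Rightarrow> 'a \<Rightarrow> 'a set" where
  "graph_ball V E r v = {u \<in> V. graph_dist E u v \<le> enat r}"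

text \<open>
  For finite \<open>V\<close> the minimum exists, since \<open>k = card V\<close> is admissible. For infinite \<open>V\<close>
  the minimum need not exist, and the value is then unspecified.
\<close>

definition burning_number :: "'a set \<Rightarrow> ('a \<times> 'a) set \<Rightarrow> nat" where
  "burning_number V E =
    (LEAST k. \<exists>v. (\<forall>r<k. v r \<in> V) \<and> (\<Union>r<k. graph_ball V E r (v r)) = V)"

text \<open>
  Galton-Watson trees in Ulam-Harris encoding: an individual is the list of birth ranks
  leading to it from the root \<open>[]\<close>, and \<open>X u\<close> is the number of children that the potential
  individual \<open>u\<close> has if it is born. The \<open>X u\<close> are i.i.d. with law \<open>\<xi>\<close>.
\<close>

definition offspring_space :: "nat pmf \<Rightarrow> (nat list \<Rightarrow> nat) measure" where
  "offspring_space \<xi> = (\<Pi>\<^sub>M u\<in>UNIV. measure_pmf \<xi>)"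

inductive_set gw_tree :: "(nat list \<Rightarrow> nat) \<Rightarrow> nat list set"
  for X :: "nat list \<Rightarrow> nat" where
  root: "[] \<in> gw_tree X"
| child: "u \<in> gw_tree X \<Longrightarrow> i < X u \<Longrightarrow> u @ [i] \<in> gw_tree X"

definition tree_edges :: "nat list set \<Rightarrow> (nat list \<times> nat list) set" where
  "tree_edges T = {(u, v). u \<in> T \<and> v \<in> T \<and> (\<exists>i. v = u @ [i] \<or> u = v @ [i])}"

definition tree_burning_number :: "nat list set \<Rightarrow> nat" where
  "tree_burning_number T = burning_number T (tree_edges T)"

definition has_size :: "nat list set \<Rightarrow> nat \<Rightarrow> bool" where
  "has_size T n \<longleftrightarrow> finite T \<and> card T = n"

text \<open>The filter of \<open>n \<rightarrow> \<infinity>\<close> along those \<open>n\<close> for which conditioning on size \<open>n\<close> makes sense.\<close>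

definition gw_sizes :: "nat pmf \<Rightarrow> nat filter" where
  "gw_sizes \<xi> = inf sequentially
     (principal {n. \<P>(X in offspring_space \<xi>. has_size (gw_tree X) n) > 0})"

end

theory Submission
  imports Defs
begin

text \<open>
  Reading the offspring numbers in depth-first order identifies trees of size \<open>n\<close> with words of
  length \<open>n\<close>, and by the cycle lemma the fringe subtrees of the conditioned tree are those read off
  from the rotations of an i.i.d. word conditioned to have sum \<open>n - 1\<close>. For a nonnegative functional
  that inspects only the first half of a word, the local limit theorem allows one to drop this
  conditioning at the cost of a constant factor, so that the expected sum of the functional over all
  fringe subtrees is \<open>O(n)\<close> times its expectation for the unconditioned tree.

  If \<open>k\<close> balls of radius less than \<open>k\<close> cover the tree, then the sum over all vertices \<open>w\<close> of the squared
  number of vertices in the first \<open>3 * k\<close> levels below \<open>w\<close> is of order at least \<open>n\<^sup>2\<close>. Its expectation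
  is \<open>O(n * k ^ 3)\<close>, so Markov's inequality bounds the probability by \<open>O(k ^ 3 / n)\<close>. Conversely, if
  \<open>N\<close> vertices have descendants \<open>r\<close> levels below them, then \<open>2 * r + N / r + 1\<close> rounds suffice. As
  the expectation of \<open>N\<close> is \<open>O(n / r)\<close> for \<open>r = O(sqrt n)\<close>, Markov's inequality with \<open>r\<close> a quarter
  of the number \<open>\<kappa>\<close> of available rounds bounds the failure probability by \<open>O(n / \<kappa> ^ 3)\<close>.
\<close>

section \<open>Depth-first words of trees\<close>

text \<open>A fringe subtree may be as large as the whole tree, so a functional that reads a
  complete subtree cannot be freed of the conditioning; both bounds are therefore built to survive
  truncation of words to length \<open>n div 2\<close>. For the lower bound it is enough that the
  balls cover the first \<open>n div 2\<close> vertices in depth-first order, still a positive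
  fraction of the tree. For the upper bound, a subtree whose first \<open>n div 2\<close> vertices
  all lie in its first \<open>r\<close> levels is untypically large there: by the second moment
  \<open>O(r ^ 3)\<close> such subtrees contribute \<open>O(r ^ 3 / n ^ 2)\<close>, which is
  \<open>O(1 / r)\<close> as long as \<open>r = O(sqrt n)\<close>. For more than order
  \<open>sqrt n\<close> rounds no probability is involved, since every tree of size \<open>n\<close>
  burns in that time. The two thresholds of the theorem are the values of \<kappa> at which the
  error terms \<open>\<kappa> ^ 3 / n\<close> and \<open>n / \<kappa> ^ 3\<close> equal \<epsilon>.
  With only two moments of \<xi> at hand, all tail estimates are instances of Markov's
  inequality.\<close>

text \<open>
  Depth-first exploration. The stack holds the vertices that have been discovered but not yet
  visited, and each visited vertex reads its number of children from the word; reading stops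
  when the stack or the word is exhausted. \<open>forest_word k\<close> recognises the words for which a
  stack of size \<open>k\<close> and the word are exhausted simultaneously.
\<close>

fun visit :: "nat list list \<Rightarrow> nat list \<Rightarrow> nat list list" where
  "visit (u # us) (c # x) = u # visit (map (\<lambda>i. u @ [i]) [0..<c] @ us) x"
| "visit us [] = []"
| "visit [] x = []"

fun explore :: "(nat list \<Rightarrow> nat) \<Rightarrow> nat list list \<Rightarrow> nat \<Rightarrow> nat list list" where
  "explore X (u # us) (Suc n) = u # explore X (map (\<lambda>i. u @ [i]) [0..<X u] @ us) n"
| "explore X us 0 = []"
| "explore X [] n = []"

fun forest_word :: "nat \<Rightarrow> nat list \<Rightarrow> bool" where
  "forest_word k [] \<longleftrightarrow> k = 0"
| "forest_word k (c # x) \<longleftrightarrow> 0 < k \<and> forest_word (k - 1 + c) x"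

definition tree_words :: "nat \<Rightarrow> nat list set" where
  "tree_words n = {x. length x = n \<and> forest_word 1 x}"

lemma visit_Nil [simp]: "visit [] x = []"
  by (cases x) auto

lemma explore_Nil [simp]: "explore X [] n = []"
  by (cases n) auto

lemma visit_append_stack:
  "visit (us @ st) z = visit us z @ visit st (drop (length (visit us z)) z)"
proof (induction us z rule: visit.induct)
  case (1 u us c x)
  then show ?case by simp
qed auto

lemma visit_map: "visit (map ((@) w) us) z = map ((@) w) (visit us z)"
proof (induction us z rule: visit.induct)
  case (1 u us c x)
  have "map ((@) w) (map (\<lambda>i. u @ [i]) [0..<c] @ us) =
      map (\<lambda>i. (w @ u) @ [i]) [0..<c] @ map ((@) w) us"
    by simp
  with 1 show ?case by (simp add: comp_def)
qed auto

lemma length_visit: "forest_word (length st) x \<Longrightarrow> length (visit st x) = length x"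
proof (induction st x rule: visit.induct)
  case (1 u us c x)
  then show ?case by (simp add: add.commute)
qed auto

lemma visit_append_word: "forest_word (length st) x \<Longrightarrow> visit st (x @ z) = visit st x"
proof (induction st x rule: visit.induct)
  case (1 u us c x)
  then show ?case by (simp add: add.commute)
qed auto

lemma visit_take: "visit st (take h x) = take h (visit st x)"
proof (induction st x arbitrary: h rule: visit.induct)
  case (1 u us c x)
  then show ?case by (cases h) auto
qed auto

text \<open>The split happens at the first time when the top \<open>j\<close> vertices of the stack
  and everything they spawned have been visited.\<close>

lemma forest_word_append:
  "forest_word (j + k) z \<Longrightarrow> \<exists>z1 z2. z = z1 @ z2 \<and> forest_word j z1 \<and> forest_word k z2"
proof (induction z arbitrary: j)
  case Nil
  then show ?case by auto
next
  case (Cons c z)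
  show ?case
  proof (cases j)
    case 0
    with Cons.prems show ?thesis by (intro exI[of _ "[]"] exI[of _ "c # z"]) auto
  next
    case (Suc i)
    with Cons.prems have "forest_word ((i + c) + k) z" by (simp add: ac_simps)
    from Cons.IH[OF this] obtain z1 z2 where
      "z = z1 @ z2" "forest_word (i + c) z1" "forest_word k z2" by blast
    with Suc show ?thesis by (intro exI[of _ "c # z1"] exI[of _ z2]) auto
  qed
qed

text \<open>\<open>rest\<close> is what lies on the stack beneath the vertex visited at time
  \<open>i\<close>; from then on the exploration is an exploration of that stack by the remaining
  letters.\<close>

lemma forest_word_drop:
  assumes "forest_word (length st) x" "i < length x"
  shows "\<exists>rest. drop i (visit st x) = visit (visit st x ! i # rest) (drop i x) \<and>
           forest_word (Suc (length rest)) (drop i x)"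
  using assms
proof (induction st x arbitrary: i rule: visit.induct)
  case (1 u us c x)
  show ?case
  proof (cases i)
    case 0
    with 1 show ?thesis by auto
  next
    case (Suc j)
    with 1 show ?thesis by (auto simp: add.commute)
  qed
qed auto

section \<open>The cycle lemma\<close>

text \<open>After \<open>i\<close> letters the stack has size
  \<open>k + sum_list (take i x) - i\<close>. This walk has to be positive before the last letter
  has been read and zero afterwards.\<close>

lemma forest_word_iff:
  "forest_word k x \<longleftrightarrow> k + sum_list x = length x \<and> (\<forall>i<length x. i < k + sum_list (take i x))"
proof (induction x arbitrary: k)
  case (Cons c x)
  show ?case
  proof (cases k)
    case 0
    have "\<exists>i<length (c # x). \<not> i < 0 + sum_list (take i (c # x))"
      by (intro exI[of _ 0]) auto
    with 0 show ?thesis by auto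
  next
    case (Suc l)
    have "(\<forall>i<length (c # x). i < k + sum_list (take i (c # x))) \<longleftrightarrow>
        (\<forall>i<length x. i < (k - 1 + c) + sum_list (take i x))"
      using Suc by (auto simp: All_less_Suc2 ac_simps)
    with Suc Cons[of "k - 1 + c"] show ?thesis by auto
  qed
qed auto

lemma tree_words_iff:
  "x \<in> tree_words n \<longleftrightarrow>
     length x = n \<and> 1 + sum_list x = n \<and> (\<forall>i<n. i \<le> sum_list (take i x))"
  by (auto simp: tree_words_def forest_word_iff)

lemma sum_list_take_drop: "sum_list (take i x) + sum_list (drop i x) = sum_list (x :: nat list)"
  by (metis append_take_drop_id sum_list.append)

text \<open>If both words were tree words for \<open>0 < i\<close>, the prefix condition of
  \<open>x\<close> would give \<open>take i x\<close> a sum of at least \<open>i\<close>, and that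
  of the rotation would give \<open>drop i x\<close> a sum of at least \<open>n - i\<close>. The
  total is only \<open>n - 1\<close>.\<close>

lemma rotate_tree_word_unique:
  assumes x: "x \<in> tree_words n" and i: "i < n" and r: "rotate i x \<in> tree_words n"
  shows "i = 0"
proof (rule ccontr)
  assume "i \<noteq> 0"
  have len: "length x = n" using x by (simp add: tree_words_iff)
  have "n - i < n" using \<open>i \<noteq> 0\<close> i by simp
  with r have "n - i \<le> sum_list (take (n - i) (rotate i x))" by (simp add: tree_words_iff)
  also have "take (n - i) (rotate i x) = drop i x"
    using i len by (simp add: rotate_drop_take)
  finally have "n - i \<le> sum_list (drop i x)" .
  moreover have "i \<le> sum_list (take i x)" using x i by (simp add: tree_words_iff)
  moreover have "1 + sum_list x = n" using x by (simp add: tree_words_iff)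
  ultimately show False using sum_list_take_drop[of i x] i by linarith
qed

text \<open>The rotation starts at the first minimum of the walk \<open>i \<mapsto> y\<^sub>1 + \<dots> + y\<^sub>i - i\<close>.\<close>

lemma rotate_tree_word_ex:
  assumes len: "length y = n" and sum: "1 + sum_list y = n"
  shows "\<exists>i<n. rotate i y \<in> tree_words n"
proof -
  define s where "s i = int (sum_list (take i y)) - int i" for i
  define m where "m = Min (s ` {..n})"
  define i where "i = (LEAST i. i \<le> n \<and> s i = m)"
  have sn: "s n = -1" using len sum by (simp add: s_def)
  have s0: "s 0 = 0" by (simp add: s_def)
  have mle: "m \<le> s j" if "j \<le> n" for j unfolding m_def using that by simp
  have "m \<in> s ` {..n}" unfolding m_def by (intro Min_in) auto
  then have ex: "\<exists>i. i \<le> n \<and> s i = m" by auto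
  have i: "i \<le> n" "s i = m" using LeastI_ex[OF ex] unfolding i_def by auto
  have first: "m < s j" if "j < i" for j
  proof -
    have "\<not> (j \<le> n \<and> s j = m)" using that not_less_Least unfolding i_def by blast
    with that i mle[of j] show ?thesis by auto
  qed
  have "m \<le> -1" using mle[of n] sn by simp
  then have "i \<noteq> 0" using i(2) s0 by (metis neg_0_le_iff_le not_one_le_zero)
  have "rotate i y = drop i y @ take i y"
  proof (cases "i = n")
    case True
    then show ?thesis using len by simp
  next
    case False
    with i len show ?thesis by (simp add: rotate_drop_take)
  qed
  moreover have "drop i y @ take i y \<in> tree_words n"
    unfolding tree_words_iff
  proof (intro conjI allI impI)
    show "length (drop i y @ take i y) = n" using i len by simp
    show "1 + sum_list (drop i y @ take i y) = n"
      using sum sum_list_take_drop[of i y] by simp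
    fix j assume "j < n"
    show "j \<le> sum_list (take j (drop i y @ take i y))"
    \<comment> \<open>Before the wrap-around, weak minimality of \<open>s i\<close> suffices. Beyond
      it the walk has lost one more unit because \<open>s n = -1\<close>, and the strict inequality
      \<open>s i < s l\<close> at earlier times makes up for exactly this unit.\<close>
    proof (cases "j \<le> n - i")
      case True
      have "sum_list (take (i + j) y) = sum_list (take i y) + sum_list (take j (drop i y))"
        by (simp add: take_add)
      moreover have "s i \<le> s (i + j)" using i mle True by auto
      moreover have "take j (drop i y @ take i y) = take j (drop i y)" using True len by simp
      ultimately show ?thesis unfolding s_def by simp
    next
      case False
      define l where "l = j - (n - i)"
      have l: "l < i" "j = (n - i) + l" using False \<open>j < n\<close> i l_def by auto
      have "take j (drop i y @ take i y) = drop i y @ take l y"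
        using l len i by (simp add: min_def)
      moreover have "s i < s l" using first[OF l(1)] i by simp
      ultimately show ?thesis
        using sum_list_take_drop[of i y] l i sum unfolding s_def by auto
    qed
  qed
  ultimately have *: "rotate i y \<in> tree_words n" by simp
  show ?thesis
  \<comment> \<open>The minimum may be attained only at the end; then \<open>y\<close> itself is the
    tree word and rotation \<open>0\<close> serves.\<close>
  proof (cases "i = n")
    case True
    then have "rotate 0 y \<in> tree_words n" using * len by simp
    moreover have "0 < n" using sum by simp
    ultimately show ?thesis by blast
  next
    case False
    with i * show ?thesis by (meson le_neq_implies_less)
  qed
qed

lemma cycle_lemma:
  assumes len: "length y = n"
  shows "card {i. i < n \<and> rotate i y \<in> tree_words n} = (if 1 + sum_list y = n then 1 else 0)"
proof (cases "1 + sum_list y = n")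
  case True
  then obtain i where i: "i < n" "rotate i y \<in> tree_words n"
    using rotate_tree_word_ex[OF len] by blast
  have "j = i" if j: "j < n" "rotate j y \<in> tree_words n" for j
  proof -
    have *: "b = a" if "a \<le> b" "b < n" "rotate a y \<in> tree_words n" "rotate b y \<in> tree_words n" for a b
    proof -
      have "rotate (b - a) (rotate a y) = rotate b y" using that by (simp add: rotate_rotate)
      then have "b - a = 0"
        using rotate_tree_word_unique[of "rotate a y" n "b - a"] that by auto
      with that show ?thesis by simp
    qed
    show ?thesis using *[of i j] *[of j i] i j by linarith
  qed
  then have "{i. i < n \<and> rotate i y \<in> tree_words n} = {i}" using i by blast
  with True show ?thesis by simp
next
  case False
  have "sum_list (rotate i y) = sum_list y" for i
    using sum_list_take_drop[of "i mod length y" y]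
    by (simp add: rotate_drop_take del: append_take_drop_id)
  then have "rotate i y \<notin> tree_words n" for i using False by (auto simp: tree_words_iff)
  with False show ?thesis by auto
qed

section \<open>Descendant sets and exploration\<close>

text \<open>Defined also for a \<open>u\<close> that is never born, so that an exploration can be
  analysed from an arbitrary stack.\<close>

definition desc :: "(nat list \<Rightarrow> nat) \<Rightarrow> nat list \<Rightarrow> nat list set" where
  "desc X u = (@) u ` gw_tree (\<lambda>v. X (u @ v))"

lemma desc_Nil [simp]: "desc X [] = gw_tree X"
  by (simp add: desc_def)

lemma gw_tree_append: "u @ v \<in> gw_tree X \<longleftrightarrow> u \<in> gw_tree X \<and> v \<in> gw_tree (\<lambda>v. X (u @ v))"
proof (induction v rule: rev_induct)
  case Nil
  show ?case by (simp add: gw_tree.root)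
next
  case (snoc i v)
  have *: "w @ [i] \<in> gw_tree Y \<longleftrightarrow> w \<in> gw_tree Y \<and> i < Y w" for w and Y :: "nat list \<Rightarrow> nat"
    by (subst gw_tree.simps) auto
  show ?case using snoc *[of "u @ v" X] *[of v "\<lambda>v. X (u @ v)"] by auto
qed

lemma gw_tree_singleton: "[i] \<in> gw_tree X \<longleftrightarrow> i < X []"
  by (subst gw_tree.simps) (auto intro: gw_tree.root)

lemma desc_step: "desc X u = insert u (\<Union>i<X u. desc X (u @ [i]))"
proof -
  have *: "v \<in> gw_tree Y \<longleftrightarrow> v = [] \<or> (\<exists>i<Y []. \<exists>w \<in> gw_tree (\<lambda>v. Y (i # v)). v = i # w)" for v Y
  proof (cases v)
    case Nil
    then show ?thesis by (simp add: gw_tree.root)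
  next
    case (Cons i w)
    then show ?thesis using gw_tree_append[of "[i]" w Y] by (auto simp: gw_tree_singleton)
  qed
  have "gw_tree Y = insert [] (\<Union>i<Y []. (#) i ` gw_tree (\<lambda>v. Y (i # v)))" for Y
  proof (rule set_eqI)
    show "v \<in> gw_tree Y \<longleftrightarrow> v \<in> insert [] (\<Union>i<Y []. (#) i ` gw_tree (\<lambda>v. Y (i # v)))" for v
      by (subst *) blast
  qed
  from this[of "\<lambda>v. X (u @ v)"] show ?thesis
    by (simp add: desc_def image_UN image_image)
qed

lemma desc_subset: "desc X u \<subseteq> range ((@) u)"
  by (auto simp: desc_def)

lemma desc_refl: "u \<in> desc X u"
  by (subst desc_step) simp

lemma desc_gw_tree: "w \<in> gw_tree X \<Longrightarrow> desc X w = {u \<in> gw_tree X. \<exists>v. u = w @ v}"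
  by (auto simp: desc_def gw_tree_append)

lemma desc_Cons:
  "(\<Union>v\<in>set (u # us). desc X v) =
     insert u (\<Union>v\<in>set (map (\<lambda>i. u @ [i]) [0..<X u] @ us). desc X v)"
proof -
  have "(\<Union>v\<in>set (u # us). desc X v) = desc X u \<union> (\<Union>v\<in>set us. desc X v)"
    by simp
  also have "desc X u = insert u (\<Union>i<X u. desc X (u @ [i]))"
    by (rule desc_step)
  finally show ?thesis by (simp add: lessThan_atLeast0 Un_assoc)
qed

text \<open>No stack entry is an ancestor of another. Full cones \<open>range ((@) u)\<close> are
  used instead of descendant sets to keep this invariant independent of the offspring
  numbers.\<close>

definition separated :: "nat list list \<Rightarrow> bool" where
  "separated = sorted_wrt (\<lambda>u v. range ((@) u) \<inter> range ((@) v) = {})"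

lemma separated_root [simp]: "separated [[]]"
  by (simp add: separated_def)

lemma separated_children:
  assumes "separated (u # us)"
  shows "separated (map (\<lambda>i. u @ [i]) [0..<c] @ us)"
proof -
  have "sorted_wrt (\<lambda>u v. range ((@) u) \<inter> range ((@) v) = {}) (map (\<lambda>i. u @ [i]) [0..<c])"
    unfolding sorted_wrt_map
    by (rule sorted_wrt_mono_rel[OF _ sorted_wrt_upt]) auto
  moreover have "range ((@) (u @ [i])) \<subseteq> range ((@) u)" for i
    by auto
  ultimately show ?thesis
    using assms by (fastforce simp: separated_def sorted_wrt_append)
qed

lemma separated_notin:
  assumes "separated (u # us)" "v \<in> set (map (\<lambda>i. u @ [i]) [0..<c] @ us)"
  shows "u \<notin> range ((@) v)"
proof -
  have "u \<in> range ((@) u)" by (auto intro: image_eqI[of _ _ "[]"])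
  with assms show ?thesis by (fastforce simp: separated_def)
qed

lemma set_visit: "set (visit st x) \<subseteq> (\<Union>u\<in>set st. range ((@) u))"
proof (induction st x rule: visit.induct)
  case (1 u us c x)
  let ?R = "\<lambda>us. \<Union>u\<in>set us. range ((@) (u :: nat list))"
  let ?children = "map (\<lambda>i. u @ [i]) [0..<c]"
  have "u \<in> range ((@) u)" by (auto intro: image_eqI[of _ _ "[]"])
  moreover have "?R ?children \<subseteq> range ((@) u)" by auto
  ultimately have A: "insert u (?R (?children @ us)) \<subseteq> ?R (u # us)"
    unfolding set_append list.set by blast
  have B: "set (visit (u # us) (c # x)) = insert u (set (visit (?children @ us) x))"
    by simp
  show ?case
    unfolding B using Set.insert_mono[OF 1, of u] A by (rule order_trans)
qed auto

lemma distinct_visit: "separated st \<Longrightarrow> distinct (visit st x)"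
proof (induction st x rule: visit.induct)
  case (1 u us c x)
  have "u \<notin> set (visit (map (\<lambda>i. u @ [i]) [0..<c] @ us) x)"
    using separated_notin[OF 1(2)] set_visit by blast
  with 1 separated_children show ?case by simp
qed auto

lemma explore_visit: "map X (visit st x) = x \<Longrightarrow> explore X st (length x) = visit st x"
  by (induction st x rule: visit.induct) auto

lemma visit_explore: "visit st (map X (explore X st n)) = explore X st n"
  by (induction X st n rule: explore.induct) auto

lemma explore_complete:
  "forest_word (length st) (map X (explore X st n)) \<Longrightarrow> set (explore X st n) = (\<Union>u\<in>set st. desc X u)"
proof (induction X st n rule: explore.induct)
  case (1 X u us n)
  then have "set (explore X (map (\<lambda>i. u @ [i]) [0..<X u] @ us) n) =
      (\<Union>v\<in>set (map (\<lambda>i. u @ [i]) [0..<X u] @ us). desc X v)"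
    by (simp add: add.commute)
  then show ?case unfolding desc_Cons by simp
qed auto

text \<open>Each visit removes exactly one vertex from the union of the descendant sets of the
  stack, because separation prevents it from turning up again. The vertices therefore run out after
  precisely \<open>n\<close> visits.\<close>

lemma explore_finite:
  assumes "separated st" "finite (\<Union>u\<in>set st. desc X u)" "card (\<Union>u\<in>set st. desc X u) = n"
  shows "length (explore X st n) = n \<and> forest_word (length st) (map X (explore X st n))"
  using assms
proof (induction X st n rule: explore.induct)
  case (1 X u us n)
  let ?D = "\<Union>u\<in>set (map (\<lambda>i. u @ [i]) [0..<X u] @ us). desc X u"
  note eq = desc_Cons[of X u us]
  have "u \<notin> ?D"
    using separated_notin[OF 1(2)] desc_subset by blast
  moreover have fin: "finite ?D" using 1(3) unfolding eq by simp
  ultimately have "card ?D = n" using 1(4) unfolding eq by simp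
  with 1(1)[OF separated_children[OF 1(2)] fin] show ?case by (simp add: add.commute)
next
  case (2 X us)
  then show ?case using desc_refl by (cases us) auto
qed auto

lemma explore_tree_word:
  assumes "x \<in> tree_words n" "map X (visit [[]] x) = x"
  shows "explore X [[]] n = visit [[]] x"
  using explore_visit[OF assms(2)] assms(1) unfolding tree_words_def by blast

lemma gw_tree_visit:
  assumes "x \<in> tree_words n" "map X (visit [[]] x) = x"
  shows "gw_tree X = set (visit [[]] x)"
proof -
  note eq = explore_tree_word[OF assms]
  have "forest_word (length [[]]) (map X (explore X [[]] n))"
    unfolding eq assms(2) using assms(1) by (simp add: tree_words_def)
  from explore_complete[OF this] show ?thesis unfolding eq by simp
qed

lemma tree_word_unique:
  assumes "x \<in> tree_words n" "map X (visit [[]] x) = x" "y \<in> tree_words n" "map X (visit [[]] y) = y"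
  shows "x = y"
proof -
  have "visit [[]] x = visit [[]] y"
    using explore_tree_word[OF assms(1,2)] explore_tree_word[OF assms(3,4)] by (rule subst)
  with assms(2,4) show ?thesis by metis
qed

section \<open>Trees of size \<open>n\<close> and their law\<close>

lemma length_visit_tree_word:
  assumes "x \<in> tree_words n"
  shows "length (visit [[]] x) = n"
  using assms length_visit[of "[[]]" x] unfolding tree_words_def by simp

lemma card_visit_tree_word:
  assumes "x \<in> tree_words n"
  shows "card (set (visit [[]] x)) = n"
  using length_visit_tree_word[OF assms] by (simp add: distinct_card distinct_visit)

text \<open>The right-hand side is a countable union of events that each constrain finitely many
  coordinates of \<open>X\<close>; this makes the size event accessible in the product
  space.\<close>

lemma has_size_iff:
  "has_size (gw_tree X) n \<longleftrightarrow> (\<exists>x\<in>tree_words n. map X (visit [[]] x) = x)"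
proof
  assume "has_size (gw_tree X) n"
  then have *: "length (explore X [[]] n) = n \<and> forest_word 1 (map X (explore X [[]] n))"
    using explore_finite[of "[[]]" X n] by (simp add: has_size_def)
  show "\<exists>x\<in>tree_words n. map X (visit [[]] x) = x"
  proof
    show "map X (visit [[]] (map X (explore X [[]] n))) = map X (explore X [[]] n)"
      by (simp only: visit_explore)
    show "map X (explore X [[]] n) \<in> tree_words n" using * by (simp add: tree_words_def)
  qed
next
  assume "\<exists>x\<in>tree_words n. map X (visit [[]] x) = x"
  then obtain x where x: "x \<in> tree_words n" "map X (visit [[]] x) = x" by blast
  show "has_size (gw_tree X) n"
    unfolding gw_tree_visit[OF x] has_size_def using card_visit_tree_word[OF x(1)] by blast
qed

text \<open>The visited vertices are distinct, so the letters can be assigned to them freely. This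
  transfers facts about \<open>gw_tree\<close> to words.\<close>

lemma offspring_function_exists:
  assumes "x \<in> tree_words n"
  shows "\<exists>X. map X (visit [[]] x) = x"
proof -
  let ?v = "visit [[]] x"
  have len: "length ?v = length x"
    using length_visit_tree_word[OF assms] assms by (simp add: tree_words_def)
  have "map (\<lambda>v. the (map_of (zip ?v x) v)) ?v = x"
    using len by (intro nth_equalityI) (auto simp: map_of_zip_nth distinct_visit)
  then show ?thesis by blast
qed

text \<open>The letters from position \<open>i\<close> on start with a block \<open>z1\<close> that
  is used up just when the stack has fallen back to \<open>rest\<close>. An exploration of
  \<open>rotate i x\<close> from the root ends after \<open>z1\<close> and ignores the letters that
  follow.\<close>

lemma subtree_word:
  assumes x: "x \<in> tree_words n" and i: "i < n"
  defines "w \<equiv> visit [[]] x ! i"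
  shows "\<exists>ys. drop i (visit [[]] x) = map ((@) w) (visit [[]] (rotate i x)) @ ys"
    and "{v. w @ v \<in> set (visit [[]] x)} = set (visit [[]] (rotate i x))"
proof -
  have len: "length x = n" using x by (simp add: tree_words_def)
  obtain rest where rest: "drop i (visit [[]] x) = visit (w # rest) (drop i x)"
      "forest_word (Suc (length rest)) (drop i x)"
    using forest_word_drop[of "[[]]" x i] x i by (auto simp: tree_words_def w_def)
  obtain z1 z2 where z: "drop i x = z1 @ z2" "forest_word 1 z1" "forest_word (length rest) z2"
    using forest_word_append[of 1 "length rest" "drop i x"] rest by auto
  have "rotate i x = z1 @ (z2 @ take i x)"
    using z(1) i len by (simp add: rotate_drop_take)
  then have rot: "visit [[]] (rotate i x) = visit [[]] z1"
    using visit_append_word[of "[[]]" z1] z(2) by simp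
  have w: "visit [w] z1 = map ((@) w) (visit [[]] z1)"
    using visit_map[of w "[[]]" z1] by simp
  have "visit [w] (z1 @ z2) = visit [w] z1"
    using visit_append_word[of "[w]" z1] z(2) by simp
  then obtain s where s: "visit (w # rest) (z1 @ z2) = visit [w] z1 @ visit rest s"
    using visit_append_stack[of "[w]" rest "z1 @ z2"] by simp
  show "\<exists>ys. drop i (visit [[]] x) = map ((@) w) (visit [[]] (rotate i x)) @ ys"
    unfolding rest(1) z(1) s rot w by blast
  \<comment> \<open>An offspring function generating \<open>x\<close> identifies the vertices
    visited by \<open>z1\<close> with the descendant set of \<open>w\<close>.\<close>
  obtain X where X: "map X (visit [[]] x) = x" using offspring_function_exists[OF x] by blast
  have "drop i x = map X (drop i (visit [[]] x))" using X by (metis drop_map)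
  then have "z1 @ z2 = map X (visit [w] z1) @ map X (visit rest s)"
    unfolding rest(1) unfolding z(1) s by simp
  moreover have "length (map X (visit [w] z1)) = length z1"
    using length_visit[of "[w]" z1] z(2) by simp
  ultimately have z1: "map X (visit [w] z1) = z1"
    by (metis append_eq_append_conv)
  have "forest_word (length [w]) (map X (explore X [w] (length z1)))"
    unfolding explore_visit[OF z1] z1 using z(2) by simp
  from explore_complete[OF this] have "desc X w = set (visit [w] z1)"
    unfolding explore_visit[OF z1] by simp
  moreover have "w \<in> set (visit [[]] x)"
    unfolding w_def using i length_visit_tree_word[OF x] by simp
  ultimately have "{u \<in> set (visit [[]] x). \<exists>v. u = w @ v} = (@) w ` set (visit [[]] z1)"
    using desc_gw_tree[of w X] gw_tree_visit[OF x X] w by simp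
  then show "{v. w @ v \<in> set (visit [[]] x)} = set (visit [[]] (rotate i x))"
    unfolding rot by (auto simp: set_eq_iff image_iff)
qed

lemma tree_word_tree:
  assumes x: "x \<in> tree_words n"
  shows "[] \<in> set (visit [[]] x)" "u @ v \<in> set (visit [[]] x) \<Longrightarrow> u \<in> set (visit [[]] x)"
proof -
  obtain X where X: "map X (visit [[]] x) = x" using offspring_function_exists[OF x] by blast
  show "[] \<in> set (visit [[]] x)" "u @ v \<in> set (visit [[]] x) \<Longrightarrow> u \<in> set (visit [[]] x)"
    using gw_tree_visit[OF x X] gw_tree_append[of u v X] gw_tree.root[of X] by auto
qed

text \<open>The event is the disjoint union of the cylinders \<open>E x\<close> over the admissible
  tree words. The vertices visited by \<open>x\<close> are distinct coordinates, so the probability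
  of \<open>E x\<close> is the product of the letter probabilities.\<close>

lemma prob_tree:
  "\<P>(X in offspring_space \<xi>. has_size (gw_tree X) n \<and> Q (gw_tree X)) =
     measure_pmf.prob (replicate_pmf n \<xi>) {x \<in> tree_words n. Q (set (visit [[]] x))}"
proof -
  let ?M = "offspring_space \<xi>"
  interpret P: product_prob_space "\<lambda>_. measure_pmf \<xi>" UNIV
    by unfold_locales
  let ?W = "{x \<in> tree_words n. Q (set (visit [[]] x))}"
  define E where "E x = {X \<in> space ?M. map X (visit [[]] x) = x}" for x
  have E: "E x \<in> sets ?M" "emeasure ?M (E x) = pmf (replicate_pmf n \<xi>) x"
    if x: "x \<in> tree_words n" for x
  proof -
    let ?v = "visit [[]] x"
    obtain Y where Y: "map Y ?v = x" using offspring_function_exists[OF x] by blast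
    have "map X ?v = x \<longleftrightarrow> (\<forall>u\<in>set ?v. X u \<in> {Y u})" for X
      unfolding Y[symmetric, THEN arg_cong[where f="\<lambda>z. map X ?v = z"]] by simp
    then have eq: "E x = {X \<in> space ?M. \<forall>u\<in>set ?v. X u \<in> {Y u}}"
      unfolding E_def by simp
    show "E x \<in> sets ?M"
      unfolding eq offspring_space_def
    proof (rule sets.sets_Collect_finite_All)
      show "{X \<in> space (\<Pi>\<^sub>M u\<in>UNIV. measure_pmf \<xi>). X u \<in> {Y u}} \<in> sets (\<Pi>\<^sub>M u\<in>UNIV. measure_pmf \<xi>)"
        for u :: "nat list"
        using measurable_sets[OF measurable_component_singleton[of u UNIV "\<lambda>_. measure_pmf \<xi>"], of "{Y u}"]
        by (simp add: vimage_def Int_def conj_commute)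
    qed simp
    have "emeasure ?M (E x) = (\<Prod>u\<in>set ?v. emeasure (measure_pmf \<xi>) {Y u})"
      unfolding eq offspring_space_def by (subst P.emeasure_PiM_Collect) auto
    also have "\<dots> = ennreal (\<Prod>u\<in>set ?v. pmf \<xi> (Y u))"
      by (simp add: emeasure_pmf_single prod_ennreal)
    also have "(\<Prod>u\<in>set ?v. pmf \<xi> (Y u)) = prod_list (map (pmf \<xi>) x)"
      by (subst Y[symmetric]) (simp add: prod.distinct_set_conv_list distinct_visit comp_def)
    also have "prod_list (map (pmf \<xi>) x) = pmf (replicate_pmf (length x) \<xi>) x"
    proof (induction x)
      case (Cons a x)
      have "pmf (replicate_pmf (Suc (length x)) \<xi>) (a # x) =
          pmf (map_pmf (\<lambda>(a, x). a # x) (pair_pmf \<xi> (replicate_pmf (length x) \<xi>))) (case (a, x) of (a, x) \<Rightarrow> a # x)"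
        by (simp add: pair_pmf_def map_bind_pmf)
      also have "\<dots> = pmf (pair_pmf \<xi> (replicate_pmf (length x) \<xi>)) (a, x)"
        by (intro pmf_map_inj') (auto intro: injI)
      finally show ?case using Cons by (simp add: pmf_pair)
    qed simp
    finally show "emeasure ?M (E x) = pmf (replicate_pmf n \<xi>) x"
      using x by (simp add: tree_words_def)
  qed
  have "{X \<in> space ?M. has_size (gw_tree X) n \<and> Q (gw_tree X)} = (\<Union>x\<in>?W. E x)"
    by (auto simp: has_size_iff E_def gw_tree_visit)
  moreover have "emeasure ?M (\<Union>x\<in>?W. E x) = (\<integral>\<^sup>+x. emeasure ?M (E x) \<partial>count_space ?W)"
    using E(1) by (intro emeasure_UN_countable)
      (auto simp: disjoint_family_on_def E_def dest: tree_word_unique)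
  moreover have "\<dots> = (\<integral>\<^sup>+x. pmf (replicate_pmf n \<xi>) x \<partial>count_space ?W)"
    using E(2) by (intro nn_integral_cong) simp
  moreover have "\<dots> = emeasure (measure_pmf (replicate_pmf n \<xi>)) ?W"
    by (rule nn_integral_pmf)
  ultimately show ?thesis
    by (simp add: measure_def)
qed

section \<open>Burning finite trees\<close>

lemma graph_dist_le_iff: "graph_dist E u v \<le> enat r \<longleftrightarrow> (\<exists>j\<le>r. (u, v) \<in> E ^^ j)"
proof
  assume le: "graph_dist E u v \<le> enat r"
  show "\<exists>j\<le>r. (u, v) \<in> E ^^ j"
  proof (rule ccontr)
    assume *: "\<not> (\<exists>j\<le>r. (u, v) \<in> E ^^ j)"
    have "enat (Suc r) \<le> graph_dist E u v"
      unfolding graph_dist_def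
    proof (rule INF_greatest)
      fix k assume "k \<in> {k. (u, v) \<in> E ^^ k}"
      with * have "\<not> k \<le> r" by blast
      then show "enat (Suc r) \<le> enat k" by simp
    qed
    from this le have "enat (Suc r) \<le> enat r" by (rule order_trans)
    then show False by simp
  qed
next
  assume "\<exists>j\<le>r. (u, v) \<in> E ^^ j"
  then obtain j where "j \<le> r" "(u, v) \<in> E ^^ j" by blast
  then have "graph_dist E u v \<le> enat j"
    unfolding graph_dist_def by (intro INF_lower) simp
  also have "enat j \<le> enat r" using \<open>j \<le> r\<close> by simp
  finally show "graph_dist E u v \<le> enat r" .
qed

definition rooted :: "nat list set \<Rightarrow> bool" where
  "rooted T \<longleftrightarrow> [] \<in> T \<and> (\<forall>u v. u @ v \<in> T \<longrightarrow> u \<in> T)"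

lemma rooted_take: "rooted T \<Longrightarrow> u \<in> T \<Longrightarrow> take m u \<in> T"
  unfolding rooted_def by (metis append_take_drop_id)

lemma walk_to_ancestor:
  assumes "rooted T" "w @ v \<in> T"
  shows "(w @ v, w) \<in> tree_edges T ^^ length v"
  using assms(2)
proof (induction v rule: rev_induct)
  case (snoc i v)
  have "w @ v \<in> T"
    using assms(1) snoc.prems unfolding rooted_def by (metis append_assoc)
  then have "(w @ v @ [i], w @ v) \<in> tree_edges T" "(w @ v, w) \<in> tree_edges T ^^ length v"
    using snoc by (auto simp: tree_edges_def)
  then show ?case using relpow_Suc_I2[of "w @ v @ [i]" "w @ v"] by simp
qed simp

text \<open>An edge only appends or deletes a last letter, so \<open>j\<close> edges leave intact
  the part of \<open>v\<close> that is at least \<open>j\<close> levels above its end.\<close>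

lemma walk_lengths:
  "(u, v) \<in> tree_edges T ^^ j \<Longrightarrow>
     length u \<le> length v + j \<and> (\<forall>m. m + j \<le> length v \<longrightarrow> take m u = take m v)"
proof (induction j arbitrary: v)
  case (Suc j)
  from Suc.prems obtain u' where u': "(u, u') \<in> tree_edges T ^^ j" "(u', v) \<in> tree_edges T"
    by (rule relpow_Suc_E)
  from u'(2) obtain i where "v = u' @ [i] \<or> u' = v @ [i]"
    unfolding tree_edges_def by blast
  then show ?case
    using Suc.IH[OF u'(1)] by fastforce
qed simp

definition burnable :: "nat list set \<Rightarrow> nat \<Rightarrow> bool" where
  "burnable T k \<longleftrightarrow>
     (\<exists>v. (\<forall>r<k. v r \<in> T) \<and> (\<Union>r<k. graph_ball T (tree_edges T) r (v r)) = T)"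

lemma tree_burning_number_eq: "tree_burning_number T = (LEAST k. burnable T k)"
  unfolding tree_burning_number_def burning_number_def burnable_def ..

section \<open>A deterministic upper bound for the number of rounds\<close>

lemma pigeonhole_sum:
  fixes f :: "nat \<Rightarrow> nat"
  assumes "0 < r"
  shows "\<exists>a<r. r * f a \<le> (\<Sum>a<r. f a)"
proof (rule ccontr)
  assume "\<not> (\<exists>a<r. r * f a \<le> (\<Sum>a<r. f a))"
  then have "(\<Sum>a<r. (\<Sum>a<r. f a)) < (\<Sum>a<r. r * f a)"
    using assms by (intro sum_strict_mono) auto
  then show False by (simp add: sum_distrib_left)
qed

text \<open>
  Centres are the root and the vertices of depth \<open>a\<close> modulo \<open>r\<close> that have descendants \<open>r\<close>
  levels below them, for the residue \<open>a\<close> with the fewest such vertices. Every vertex lies fewer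
  than \<open>2 * r\<close> levels below one of these.
\<close>

lemma burnable_upper:
  assumes T: "finite T" "rooted T" and r: "0 < r"
  shows "\<exists>s. r * s \<le> card {w \<in> T. \<exists>v. length v = r \<and> w @ v \<in> T} \<and> burnable T (2 * r + s + 1)"
proof -
  define N where "N = {w \<in> T. \<exists>v. length v = r \<and> w @ v \<in> T}"
  define S where "S a = {w \<in> N. length w mod r = a}" for a
  have fin: "finite N" "finite (S a)" for a using T by (auto simp: N_def S_def)
  have "N = (\<Union>a<r. S a)" using r by (auto simp: S_def)
  then have "card N = (\<Sum>a<r. card (S a))"
    using fin by (simp only:) (intro card_UN_disjoint, auto simp: S_def)
  with pigeonhole_sum[OF r, of "\<lambda>a. card (S a)"] obtain a where
    a: "a < r" "r * card (S a) \<le> card N" by auto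
  define s where "s = card (S a)"
  obtain f where f: "bij_betw f {..<s} (S a)"
    using ex_bij_betw_nat_finite[OF fin(2)[of a]] unfolding s_def atLeast0LessThan by blast
  \<comment> \<open>The \<open>s\<close> centres receive the radii from \<open>2 * r\<close> to
    \<open>2 * r + s - 1\<close>, and the root receives radius \<open>2 * r + s\<close> for the
    vertices of small depth. Smaller radii are parked at the root as well.\<close>
  define v where "v i = (if 2 * r \<le> i \<and> i < 2 * r + s then f (i - 2 * r) else [])" for i
  have v: "v i \<in> T" for i
  proof (cases "2 * r \<le> i \<and> i < 2 * r + s")
    case True
    then have "f (i - 2 * r) \<in> S a" using f by (auto simp: bij_betw_def)
    with True show ?thesis by (simp add: v_def S_def N_def)
  next
    case False
    then have "v i = []" unfolding v_def by (rule if_not_P)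
    then show ?thesis using T(2) by (simp add: rooted_def)
  qed
  have ball: "u \<in> graph_ball T (tree_edges T) i (v i)"
    if "u \<in> T" "v i = take d u" "d \<le> length u" "length u - d \<le> i" for u i d
  proof -
    have "(take d u @ drop d u, take d u) \<in> tree_edges T ^^ length (drop d u)"
      using T(2) that by (intro walk_to_ancestor) simp_all
    with that show ?thesis
      unfolding graph_ball_def graph_dist_le_iff by auto
  qed
  have "\<exists>i<2 * r + s + 1. u \<in> graph_ball T (tree_edges T) i (v i)" if u: "u \<in> T" for u
  proof (cases "length u < 2 * r")
    case True
    then show ?thesis
      using u by (intro exI[of _ "2 * r + s"] conjI ball[of _ _ 0]) (simp_all add: v_def)
  next
    case False
    define m where "m = length u - r"
    \<comment> \<open>The largest depth congruent to \<open>a\<close> that is at most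
      \<open>length u - r\<close>: the ancestor of \<open>u\<close> there has descendants
      \<open>r\<close> levels below it, and \<open>u\<close> is fewer than \<open>2 * r\<close>
      levels away.\<close>
    define d where "d = m - (m - a) mod r"
    have m: "r \<le> m" "length u = m + r" using False by (auto simp: m_def)
    have lt: "(m - a) mod r < r" using r by simp
    have le: "(m - a) mod r \<le> m - a" by simp
    have d: "d \<le> m" "m < d + r" using lt m by (auto simp: d_def)
    have "d = (m - a) div r * r + a"
      using le a m div_mult_mod_eq[of "m - a" r] unfolding d_def by linarith
    then have "d mod r = a" using a by simp
    moreover have "take d u \<in> N"
    proof -
      have "take d u @ take r (drop d u) \<in> T"
        using rooted_take[OF T(2) u, of "d + r"] by (simp add: take_add)
      moreover have "length (take r (drop d u)) = r" using d m by simp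
      ultimately show ?thesis using rooted_take[OF T(2) u] unfolding N_def by blast
    qed
    ultimately have "take d u \<in> S a" using d m by (simp add: S_def)
    then have "take d u \<in> f ` {..<s}" using f by (simp add: bij_betw_def)
    then obtain i where i: "i < s" "f i = take d u" by auto
    show ?thesis
    proof (intro exI conjI ball)
      show "u \<in> T" "d \<le> length u" using u d m by auto
      show "v (2 * r + i) = take d u" "2 * r + i < 2 * r + s + 1" using i by (auto simp: v_def)
      show "length u - d \<le> 2 * r + i" using m d by auto
    qed
  qed
  then have "T \<subseteq> (\<Union>i<2 * r + s + 1. graph_ball T (tree_edges T) i (v i))" by blast
  moreover have "(\<Union>i<2 * r + s + 1. graph_ball T (tree_edges T) i (v i)) \<subseteq> T"
    by (auto simp: graph_ball_def)
  ultimately have "burnable T (2 * r + s + 1)"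
    unfolding burnable_def using v by (intro exI[of _ v]) blast
  with a show ?thesis unfolding N_def s_def by blast
qed

lemma burnable_tree_burning_number:
  assumes "finite T" "rooted T"
  shows "burnable T (tree_burning_number T)"
  unfolding tree_burning_number_eq using burnable_upper[OF assms, of 1] by (metis LeastI less_numeral_extra(1))

lemma tree_burning_number_upper:
  assumes "finite T" "rooted T" "0 < r"
  shows "real (tree_burning_number T) \<le>
    2 * real r + real (card {w \<in> T. \<exists>v. length v = r \<and> w @ v \<in> T}) / real r + 1"
proof -
  obtain s where s: "r * s \<le> card {w \<in> T. \<exists>v. length v = r \<and> w @ v \<in> T}"
      "burnable T (2 * r + s + 1)"
    using burnable_upper[OF assms] by blast
  have "tree_burning_number T \<le> 2 * r + s + 1"
    unfolding tree_burning_number_eq using s(2) by (rule Least_le)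
  then have "real (tree_burning_number T) \<le> 2 * real r + real s + 1" by linarith
  moreover have "real s \<le> real (card {w \<in> T. \<exists>v. length v = r \<and> w @ v \<in> T}) / real r"
    using s(1) assms(3) by (simp add: field_simps flip: of_nat_mult)
  ultimately show ?thesis by linarith
qed

section \<open>A deterministic lower bound for the number of rounds\<close>

lemma sum_squares_le_square_sum:
  fixes f :: "'a \<Rightarrow> real"
  assumes "finite A" "\<And>x. x \<in> A \<Longrightarrow> 0 \<le> f x"
  shows "(\<Sum>x\<in>A. (f x)\<^sup>2) \<le> (\<Sum>x\<in>A. f x)\<^sup>2"
proof -
  have "(\<Sum>x\<in>A. (f x)\<^sup>2) = (\<Sum>x\<in>A. f x * f x)" by (simp add: power2_eq_square)
  also have "\<dots> \<le> (\<Sum>x\<in>A. f x * (\<Sum>y\<in>A. f y))"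
    using assms by (intro sum_mono mult_left_mono member_le_sum) auto
  finally show ?thesis by (simp add: power2_eq_square sum_distrib_right)
qed

text \<open>
  A ball of radius less than \<open>k\<close> whose centre has depth at least \<open>2 * k\<close> is contained in the first
  \<open>3 * k\<close> levels below each of the \<open>k\<close> ancestors of the centre at distance \<open>k, \<dots>, 2 * k - 1\<close>. The
  Cauchy-Schwarz loss from having \<open>k\<close> balls is thus made up for by counting every ball \<open>k\<close>
  times. All other balls lie in the first \<open>3 * k\<close> levels of the tree.
\<close>

lemma burnable_lower:
  assumes T: "finite T" "rooted T" and H: "H \<subseteq> T" and k: "burnable T k"
  shows "(real (card H))\<^sup>2 \<le>
    4 * (\<Sum>w\<in>T. (real (card {u \<in> H. \<exists>z. u = w @ z \<and> length z < 3 * k}))\<^sup>2)"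
proof -
  define D where "D w = {u \<in> H. \<exists>z. u = w @ z \<and> length z < 3 * k}" for w
  have finH: "finite H" using T H by (rule_tac finite_subset)
  then have finD: "finite (D w)" for w by (simp add: D_def)
  obtain v where v: "\<And>i. i < k \<Longrightarrow> v i \<in> T" "(\<Union>i<k. graph_ball T (tree_edges T) i (v i)) = T"
    using k unfolding burnable_def by blast
  have "\<forall>u\<in>H. \<exists>i<k. u \<in> graph_ball T (tree_edges T) i (v i)" using v(2) H by blast
  then obtain c where c: "\<And>u. u \<in> H \<Longrightarrow> c u < k \<and> u \<in> graph_ball T (tree_edges T) (c u) (v (c u))"
    by metis
  \<comment> \<open>Each vertex of \<open>H\<close> is charged to a single covering ball; the cells
    are then disjoint and their sizes add up.\<close>
  define C where "C i = {u \<in> H. c u = i}" for i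
  have finC: "finite (C i)" for i using finH by (simp add: C_def)
  have C: "length u \<le> length (v i) + i"
      "m + i \<le> length (v i) \<Longrightarrow> take m u = take m (v i)" if "u \<in> C i" for u i m
  proof -
    from that c obtain j where "j \<le> i" "(u, v i) \<in> tree_edges T ^^ j"
      by (auto simp: C_def graph_ball_def graph_dist_le_iff)
    then show "length u \<le> length (v i) + i"
      "m + i \<le> length (v i) \<Longrightarrow> take m u = take m (v i)"
      using walk_lengths[of u "v i" j T] by auto
  qed
  define deep where "deep = {i. i < k \<and> 2 * k \<le> length (v i)}"
  define shallow where "shallow = {i. i < k \<and> length (v i) < 2 * k}"
  have fin: "finite deep" "finite shallow" by (auto simp: deep_def shallow_def)
  define anc where "anc i = (\<lambda>j. take (length (v i) - k - j) (v i)) ` {..<k}" for i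
  have anc: "card (anc i) = k" "anc i \<subseteq> T" if "i \<in> deep" for i
  proof -
    have "inj_on (\<lambda>j. take (length (v i) - k - j) (v i)) {..<k}"
    proof (rule inj_onI)
      fix j j' assume *: "j \<in> {..<k}" "j' \<in> {..<k}"
        "take (length (v i) - k - j) (v i) = take (length (v i) - k - j') (v i)"
      from arg_cong[OF *(3), of length] * that show "j = j'" by (auto simp: deep_def)
    qed
    then show "card (anc i) = k" unfolding anc_def by (simp add: card_image)
    show "anc i \<subseteq> T" unfolding anc_def using rooted_take[OF T(2)] v(1) that by (auto simp: deep_def)
  qed
  have CD: "C i \<subseteq> D w" if i: "i \<in> deep" and w: "w \<in> anc i" for i w
  proof
    fix u assume u: "u \<in> C i"
    obtain j where j: "j < k" "w = take (length (v i) - k - j) (v i)" using w by (auto simp: anc_def)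
    let ?m = "length (v i) - k - j"
    have "take ?m u = w" using C(2)[OF u, of ?m] i j by (auto simp: deep_def)
    then have "u = w @ drop ?m u" by (metis append_take_drop_id)
    moreover have "length (drop ?m u) < 3 * k" using C(1)[OF u] i j by (auto simp: deep_def)
    moreover have "u \<in> H" using u by (simp add: C_def)
    ultimately show "u \<in> D w" unfolding D_def by blast
  qed
  have CD0: "C i \<subseteq> D []" if i: "i \<in> shallow" for i
  proof
    fix u assume u: "u \<in> C i"
    then show "u \<in> D []" using C(1)[OF u] i by (auto simp: D_def shallow_def C_def)
  qed
  have sum_card: "(\<Sum>i\<in>I. real (card (C i))) = real (card (\<Union>i\<in>I. C i))" if "finite I" for I
  proof -
    have "card (\<Union>i\<in>I. C i) = (\<Sum>i\<in>I. card (C i))"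
      using that finC by (intro card_UN_disjoint) (auto simp: C_def)
    then show ?thesis by simp
  qed
  let ?S = "\<Sum>w\<in>T. (real (card (D w)))\<^sup>2"
  \<comment> \<open>The cells of all balls that have \<open>w\<close> among their chosen ancestors
    are disjoint subsets of \<open>D w\<close>, so even the square of their total size is bounded by
    that of \<open>card (D w)\<close>.\<close>
  have D: "(\<Sum>i\<in>deep. if w \<in> anc i then (real (card (C i)))\<^sup>2 else 0) \<le> (real (card (D w)))\<^sup>2" for w
  proof -
    let ?I = "{i \<in> deep. w \<in> anc i}"
    have "(\<Sum>i\<in>deep. if w \<in> anc i then (real (card (C i)))\<^sup>2 else 0) = (\<Sum>i\<in>?I. (real (card (C i)))\<^sup>2)"
      using fin by (simp add: sum.inter_filter)
    also have "\<dots> \<le> (\<Sum>i\<in>?I. real (card (C i)))\<^sup>2"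
      using fin by (intro sum_squares_le_square_sum) auto
    also have "(\<Sum>i\<in>?I. real (card (C i))) = real (card (\<Union>i\<in>?I. C i))"
      using fin by (intro sum_card) simp
    also have "\<dots>\<^sup>2 \<le> (real (card (D w)))\<^sup>2"
      using CD finD by (intro power_mono of_nat_mono card_mono) auto
    finally show ?thesis .
  qed
  have "(\<Sum>i\<in>deep. real (card (C i)))\<^sup>2 \<le> (\<Sum>i\<in>deep. (real (card (C i)))\<^sup>2) * real (card deep)"
    by (rule sum_squared_le_sum_of_squares)
  also have "\<dots> \<le> (\<Sum>i\<in>deep. (real (card (C i)))\<^sup>2) * real k"
  proof (intro mult_left_mono of_nat_mono sum_nonneg)
    have "card deep \<le> card {..<k}" by (intro card_mono) (auto simp: deep_def)
    then show "card deep \<le> k" by simp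
  qed auto
  also have "\<dots> = (\<Sum>i\<in>deep. \<Sum>w\<in>T. if w \<in> anc i then (real (card (C i)))\<^sup>2 else 0)"
  proof -
    have "(\<Sum>w\<in>T. if w \<in> anc i then (real (card (C i)))\<^sup>2 else 0) = (real (card (C i)))\<^sup>2 * real k"
      if "i \<in> deep" for i
    proof -
      have "(\<Sum>w\<in>T. if w \<in> anc i then (real (card (C i)))\<^sup>2 else 0) =
          (\<Sum>w\<in>T \<inter> anc i. (real (card (C i)))\<^sup>2)"
        by (rule sum.inter_restrict[OF T(1), symmetric])
      also have "T \<inter> anc i = anc i" using anc(2)[OF that] by blast
      finally show ?thesis using anc(1)[OF that] by simp
    qed
    then show ?thesis by (simp add: sum_distrib_right)
  qed
  also have "\<dots> = (\<Sum>w\<in>T. \<Sum>i\<in>deep. if w \<in> anc i then (real (card (C i)))\<^sup>2 else 0)"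
    by (rule sum.swap)
  also have "\<dots> \<le> ?S" by (intro sum_mono D)
  finally have deep: "(\<Sum>i\<in>deep. real (card (C i)))\<^sup>2 \<le> ?S" .
  have "(\<Sum>i\<in>shallow. real (card (C i)))\<^sup>2 \<le> (real (card (D [])))\<^sup>2"
    unfolding sum_card[OF fin(2)] using CD0 finD by (intro power_mono of_nat_mono card_mono) auto
  also have "\<dots> \<le> ?S"
    using T by (intro member_le_sum) (auto simp: rooted_def)
  finally have shallow: "(\<Sum>i\<in>shallow. real (card (C i)))\<^sup>2 \<le> ?S" .
  have "H = (\<Union>i\<in>deep \<union> shallow. C i)"
    using c by (auto simp: C_def deep_def shallow_def)
  then have "real (card H) = (\<Sum>i\<in>deep \<union> shallow. real (card (C i)))"
    using fin by (simp only: sum_card finite_Un)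
  also have "\<dots> = (\<Sum>i\<in>deep. real (card (C i))) + (\<Sum>i\<in>shallow. real (card (C i)))"
    using fin by (intro sum.union_disjoint) (auto simp: deep_def shallow_def)
  finally have "real (card H) = (\<Sum>i\<in>deep. real (card (C i))) + (\<Sum>i\<in>shallow. real (card (C i)))" .
  moreover have "(x + y)\<^sup>2 \<le> 2 * x\<^sup>2 + 2 * y\<^sup>2" for x y :: real
    using zero_le_power2[of "x - y"] by (simp add: power2_sum power2_diff)
  ultimately have "(real (card H))\<^sup>2 \<le> 2 * (\<Sum>i\<in>deep. real (card (C i)))\<^sup>2 +
      2 * (\<Sum>i\<in>shallow. real (card (C i)))\<^sup>2"
    by simp
  with deep shallow show ?thesis unfolding D_def by linarith
qed

section \<open>The local limit theorem\<close>

lemma expectation_bind_pmf_bounded: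
  fixes f :: "'a \<Rightarrow> complex"
  assumes "\<And>x. norm (f x) \<le> 1"
  shows "measure_pmf.expectation (bind_pmf p q) f =
    measure_pmf.expectation p (\<lambda>x. measure_pmf.expectation (q x) f)"
proof -
  have bind: "measure_pmf.expectation (bind_pmf p q) g =
      measure_pmf.expectation p (\<lambda>x. measure_pmf.expectation (q x) g)"
    if "\<And>x. \<bar>g x\<bar> \<le> 1" for g :: "'a \<Rightarrow> real"
    unfolding measure_pmf_bind
    by (rule integral_bind[where K="count_space UNIV" and B=1 and B'=1])
      (use that in \<open>auto simp: measure_pmf_in_subprob_algebra measure_pmf.emeasure_space_1 intro!: measure_pmf.finite_measure\<close>)
  have int: "integrable (measure_pmf r) f" for r :: "'a pmf"
    using assms by (intro measure_pmf.integrable_const_bound[where B=1]) auto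
  have int': "integrable (measure_pmf p) (\<lambda>x. measure_pmf.expectation (q x) f)"
  proof (intro measure_pmf.integrable_const_bound[where B=1])
    have "norm (measure_pmf.expectation (q x) f) \<le> 1" for x
    proof -
      have "norm (measure_pmf.expectation (q x) f) \<le> measure_pmf.expectation (q x) (\<lambda>x. norm (f x))"
        by (rule integral_norm_bound)
      also have "\<dots> \<le> measure_pmf.expectation (q x) (\<lambda>x. 1)"
        using assms int by (intro integral_mono integrable_norm) auto
      finally show ?thesis by simp
    qed
    then show "AE x in measure_pmf p. norm (measure_pmf.expectation (q x) f) \<le> 1" by simp
  qed simp
  have "\<bar>Re (f x)\<bar> \<le> 1" "\<bar>Im (f x)\<bar> \<le> 1" for x
    using assms[of x] abs_Re_le_cmod[of "f x"] abs_Im_le_cmod[of "f x"] by linarith+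
  from bind[of "\<lambda>x. Re (f x)", OF this(1)] bind[of "\<lambda>x. Im (f x)", OF this(2)]
  show ?thesis
    by (simp add: complex_eq_iff integral_Re[OF int] integral_Im[OF int] integral_Re[OF int'] integral_Im[OF int'])
qed

text \<open>Orthogonality of characters: for \<open>j\<close> a nonzero multiple of \<open>d\<close>
  the antiderivative takes the same value at both ends of the interval, whose length
  \<open>2 * pi / d\<close> is a period.\<close>

lemma integral_iexp_Icc:
  assumes "0 < d" "int d dvd j"
  shows "(\<integral>t. indicator {-pi/d..pi/d} t *\<^sub>R iexp (t * real_of_int j) \<partial>lborel) =
    (if j = 0 then 2 * pi / d else 0)"
proof (cases "j = 0")
  case True
  then show ?thesis using assms(1) by (simp add: scaleR_conv_of_real)
next
  case False
  obtain m where m: "j = int d * m" using assms(2) by (rule dvdE)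
  let ?F = "\<lambda>t. iexp (t * real_of_int j) / (\<i> * complex_of_real (real_of_int j))"
  have "(\<integral>t. indicator {-pi/d..pi/d} t *\<^sub>R iexp (t * real_of_int j) \<partial>lborel) = ?F (pi/d) - ?F (-pi/d)"
  proof (rule integral_FTC_Icc)
    show "(?F has_vector_derivative iexp (t * real_of_int j)) (at t within {-pi/d..pi/d})" for t
    proof -
      have minus: "- (\<i> * (z * \<i>)) = z" for z
        by (simp add: mult.commute[of z])
      have "((\<lambda>z. exp (\<i> * (z * of_int j)) / (\<i> * of_int j)) has_field_derivative
          exp (\<i> * (complex_of_real t * of_int j))) (at (of_real t))"
        using False minus by (auto intro!: derivative_eq_intros)
      from has_vector_derivative_real_field[OF this] show ?thesis by simp
    qed
  qed (use assms in \<open>auto intro!: continuous_intros divide_right_mono\<close>)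
  also have "iexp (pi / d * real_of_int j) = iexp (- pi / d * real_of_int j)"
  proof -
    have "iexp (pi * real_of_int m) = iexp (- pi * real_of_int m)"
      unfolding exp_eq by (rule exI[of _ m]) (simp add: complex_eq_iff)
    then show ?thesis using m assms(1) by simp
  qed
  finally show ?thesis using False by simp
qed

text \<open>Fubini, justified by a bounded integrand on a finite interval, reduces this to
  orthogonality of characters. Since \<open>f\<close> takes values in the multiples of
  \<open>d\<close>, the short interval suffices; there the characteristic function has no second
  peak.\<close>

lemma pmf_Fourier_inversion:
  fixes q :: "'a pmf" and f :: "'a \<Rightarrow> int"
  assumes "0 < d" "\<And>x. x \<in> set_pmf q \<Longrightarrow> int d dvd f x"
  shows "complex_of_real (2 * pi / d * measure_pmf.prob q {x. f x = 0}) =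
    (\<integral>t. indicator {-pi/d..pi/d} t *\<^sub>R measure_pmf.expectation q (\<lambda>x. iexp (t * real_of_int (f x))) \<partial>lborel)"
proof -
  interpret pair_sigma_finite lborel "measure_pmf q"
    by unfold_locales
  let ?g = "\<lambda>t x. indicator {-pi/d..pi/d} t *\<^sub>R iexp (t * real_of_int (f x))"
  define G where "G = (\<lambda>(t, x). ?g t x)"
  have G [measurable]: "G \<in> borel_measurable (lborel \<Otimes>\<^sub>M measure_pmf q)"
  proof -
    have [measurable]: "(\<lambda>x. real_of_int (f (snd x))) \<in> borel_measurable (lborel \<Otimes>\<^sub>M measure_pmf q)"
      by (rule measurable_compose[OF measurable_snd]) simp
    show ?thesis unfolding G_def by measurable
  qed
  have "integrable (lborel \<Otimes>\<^sub>M measure_pmf q) G"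
  proof (rule integrableI_bounded)
    have "(\<integral>\<^sup>+z. ennreal (norm (G z)) \<partial>(lborel \<Otimes>\<^sub>M measure_pmf q)) =
        (\<integral>\<^sup>+t. \<integral>\<^sup>+x. ennreal (norm (G (t, x))) \<partial>measure_pmf q \<partial>lborel)"
      by (rule measure_pmf.nn_integral_fst[symmetric]) measurable
    also have "\<dots> = (\<integral>\<^sup>+t. indicator {-pi/d..pi/d} t \<partial>lborel)"
      unfolding G_def
      by (intro nn_integral_cong) (auto split: split_indicator simp: measure_pmf.emeasure_space_1)
    also have "\<dots> < \<infinity>" by simp
    finally show "(\<integral>\<^sup>+z. ennreal (norm (G z)) \<partial>(lborel \<Otimes>\<^sub>M measure_pmf q)) < \<infinity>" .
  qed measurable
  then have "integrable (lborel \<Otimes>\<^sub>M measure_pmf q) (\<lambda>(t, x). ?g t x)" unfolding G_def .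
  from Fubini_integral[OF this]
  have "(\<integral>t. indicator {-pi/d..pi/d} t *\<^sub>R measure_pmf.expectation q (\<lambda>x. iexp (t * real_of_int (f x))) \<partial>lborel) =
      measure_pmf.expectation q (\<lambda>x. \<integral>t. ?g t x \<partial>lborel)"
    by simp
  also have "\<dots> = measure_pmf.expectation q (\<lambda>x. complex_of_real (2 * pi / d * indicator {x. f x = 0} x))"
    using integral_iexp_Icc[OF assms(1)] assms(2)
    by (intro integral_cong_AE) (auto simp: AE_measure_pmf_iff split: split_indicator)
  also have "\<dots> = complex_of_real (2 * pi / d * measure_pmf.prob q {x. f x = 0})"
    by (simp add: integral_complex_of_real)
  finally show ?thesis by simp
qed

section \<open>The characteristic function of one step\<close>

locale critical_offspring =
  fixes \<xi> :: "nat pmf"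
  assumes integrable_id: "integrable (measure_pmf \<xi>) real"
    and mean: "measure_pmf.expectation \<xi> real = 1"
    and integrable_square: "integrable (measure_pmf \<xi>) (\<lambda>k. (real k)\<^sup>2)"
    and variance_pos: "0 < measure_pmf.variance \<xi> real"
begin

abbreviation sigma2 :: real where
  "sigma2 \<equiv> measure_pmf.variance \<xi> real"

text \<open>The characteristic function of \<open>real k - 1\<close>, the centred increment of the
  depth-first walk.\<close>

definition \<psi> :: "real \<Rightarrow> complex" where
  "\<psi> t = measure_pmf.expectation \<xi> (\<lambda>k. iexp (t * (real k - 1)))"

lemma \<psi>_char: "\<psi> = char (distr (measure_pmf \<xi>) borel (\<lambda>k. real k - 1))"
  unfolding \<psi>_def char_def by (intro ext) (simp add: integral_distr)

lemma real_distribution_step: "real_distribution (distr (measure_pmf \<xi>) borel (\<lambda>k. real k - 1))"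
  by (rule prob_space.real_distribution_distr[OF prob_space_measure_pmf]) simp

lemma norm_\<psi>_le_1: "norm (\<psi> t) \<le> 1"
  unfolding \<psi>_char by (rule real_distribution.cmod_char_le_1[OF real_distribution_step])

lemma isCont_\<psi>: "isCont \<psi> t"
  unfolding \<psi>_char by (rule real_distribution.isCont_char[OF real_distribution_step])

lemma measurable_\<psi> [measurable]: "\<psi> \<in> borel_measurable borel"
  unfolding \<psi>_char by (rule real_distribution.char_measurable[OF real_distribution_step])

lemma integrable_step: "integrable (measure_pmf \<xi>) (\<lambda>k. real k - 1)"
  using integrable_id by simp

lemma integrable_step2: "integrable (measure_pmf \<xi>) (\<lambda>k. (real k - 1)\<^sup>2)"
  using integrable_id integrable_square by (simp add: power2_diff)

lemma sigma2_eq: "sigma2 = measure_pmf.expectation \<xi> (\<lambda>k. (real k - 1)\<^sup>2)"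
  by (simp add: mean)

text \<open>In the Taylor remainder \<open>t ^ 2 / 6 * G t\<close> the factor \<open>G t\<close>
  vanishes as \<open>t\<close> tends to \<open>0\<close>, by dominated convergence with the second
  moment as majorant. It is enough to see this along \<open>1 / Suc n\<close>, since
  \<open>G t\<close> is monotone in \<open>\<bar>t\<bar>\<close>.\<close>

lemma \<psi>_quadratic:
  assumes "0 < e"
  shows "\<exists>\<delta>>0. \<forall>t. \<bar>t\<bar> \<le> \<delta> \<longrightarrow> norm (\<psi> t - (1 - t\<^sup>2 * sigma2 / 2)) \<le> e * t\<^sup>2"
proof -
  define G where "G t = measure_pmf.expectation \<xi> (\<lambda>k. min (6 * (real k - 1)\<^sup>2) (\<bar>t\<bar> * \<bar>real k - 1\<bar> ^ 3))" for t
  have int: "integrable (measure_pmf \<xi>) (\<lambda>k. min (6 * (real k - 1)\<^sup>2) (\<bar>t\<bar> * \<bar>real k - 1\<bar> ^ 3))" for t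
    by (rule Bochner_Integration.integrable_bound[OF integrable_mult_right[OF integrable_step2, of 6]])
      (auto simp: min_def)
  have approx: "norm (\<psi> t - (1 - t\<^sup>2 * sigma2 / 2)) \<le> t\<^sup>2 / 6 * G t" for t
    unfolding \<psi>_char G_def
    by (rule prob_space.char_approx3'[OF prob_space_measure_pmf]) (use integrable_step integrable_step2 integrable_id mean in \<open>auto simp: sigma2_eq\<close>)
  have "(\<lambda>n. G (1 / real (Suc n))) \<longlonglongrightarrow> measure_pmf.expectation \<xi> (\<lambda>k. 0)"
    unfolding G_def
  proof (rule integral_dominated_convergence[where w="\<lambda>k. 6 * (real k - 1)\<^sup>2"])
    show "AE k in measure_pmf \<xi>. (\<lambda>n. min (6 * (real k - 1)\<^sup>2) (\<bar>1 / real (Suc n)\<bar> * \<bar>real k - 1\<bar> ^ 3)) \<longlonglongrightarrow> 0"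
    proof (rule AE_I2)
      fix k :: nat
      have "(\<lambda>n. \<bar>1 / real (Suc n)\<bar> * \<bar>real k - 1\<bar> ^ 3) \<longlonglongrightarrow> 0 * \<bar>real k - 1\<bar> ^ 3"
        using LIMSEQ_inverse_real_of_nat by (intro tendsto_mult tendsto_const) (simp add: inverse_eq_divide)
      then have "(\<lambda>n. \<bar>1 / real (Suc n)\<bar> * \<bar>real k - 1\<bar> ^ 3) \<longlonglongrightarrow> 0" by simp
      then show "(\<lambda>n. min (6 * (real k - 1)\<^sup>2) (\<bar>1 / real (Suc n)\<bar> * \<bar>real k - 1\<bar> ^ 3)) \<longlonglongrightarrow> 0"
        by (rule tendsto_sandwich[OF _ _ tendsto_const, rotated 2]) auto
    qed
  qed (use integrable_step2 in \<open>auto simp: min_def\<close>)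
  then have "\<forall>\<^sub>F n in sequentially. G (1 / real (Suc n)) < 6 * e"
    using assms by (intro order_tendstoD(2)) auto
  then obtain n where n: "G (1 / real (Suc n)) < 6 * e" by (auto simp: eventually_sequentially)
  have "norm (\<psi> t - (1 - t\<^sup>2 * sigma2 / 2)) \<le> e * t\<^sup>2" if t: "\<bar>t\<bar> \<le> 1 / real (Suc n)" for t
  proof -
    have "G t \<le> G (1 / real (Suc n))"
      unfolding G_def
    proof (intro integral_mono int min.mono mult_right_mono)
      show "\<bar>t\<bar> \<le> \<bar>1 / real (Suc n)\<bar>" using t by simp
    qed auto
    with n have "G t \<le> 6 * e" by simp
    then have "t\<^sup>2 / 6 * G t \<le> t\<^sup>2 / 6 * (6 * e)" by (intro mult_left_mono) auto
    with approx[of t] show ?thesis by (simp add: mult.commute)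
  qed
  then show ?thesis by (intro exI[of _ "1 / real (Suc n)"]) auto
qed

text \<open>Otherwise the centred step would be nonnegative with mean zero, hence constant, contrary
  to the positive variance.\<close>

lemma zero_in_support: "0 \<in> set_pmf \<xi>"
proof (rule ccontr)
  assume "0 \<notin> set_pmf \<xi>"
  then have nonneg: "AE k in measure_pmf \<xi>. 0 \<le> real k - 1"
    by (auto simp: AE_measure_pmf_iff) (metis One_nat_def Suc_leI gr0I of_nat_1 of_nat_le_iff)
  have "measure_pmf.expectation \<xi> (\<lambda>k. real k - 1) = 0"
    using integrable_id mean by simp
  with integral_nonneg_eq_0_iff_AE[OF integrable_step nonneg]
  have "AE k in measure_pmf \<xi>. real k - 1 = 0" by simp
  then have "sigma2 = measure_pmf.expectation \<xi> (\<lambda>k. 0)"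
    unfolding sigma2_eq by (intro integral_cong_AE) auto
  with variance_pos show False by simp
qed

text \<open>
  Since \<open>0\<close> is in the support, this is the span of the lattice on which the partial sums live.
\<close>

definition period :: nat where
  "period = Gcd (set_pmf \<xi>)"

lemma period_dvd: "k \<in> set_pmf \<xi> \<Longrightarrow> period dvd k"
  unfolding period_def by (rule Gcd_dvd)

lemma ex_pos_in_support: "\<exists>k\<in>set_pmf \<xi>. 0 < k"
proof (rule ccontr)
  assume "\<not> (\<exists>k\<in>set_pmf \<xi>. 0 < k)"
  then have "measure_pmf.expectation \<xi> real = measure_pmf.expectation \<xi> (\<lambda>k. 0)"
    by (intro integral_cong_AE) (auto simp: AE_measure_pmf_iff)
  with mean show False by simp
qed

lemma period_pos: "0 < period"
  using ex_pos_in_support period_dvd by (metis dvd_0_left_iff gr0I less_numeral_extra(3))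

text \<open>Modulus one means equality in the triangle inequality, so
  \<open>iexp (t * (real k - 1))\<close> is constant on the support. Comparison with
  \<open>k = 0\<close> gives \<open>iexp (t * real k) = 1\<close> there. The numbers with this
  property are multiples of the least positive one, so they include \<open>period\<close>; but
  \<open>t * period\<close> is then a multiple of \<open>2 * pi\<close>, which leaves only
  \<open>t = 0\<close>.\<close>

lemma norm_\<psi>_less_1:
  assumes t: "\<bar>t\<bar> \<le> pi / period" "t \<noteq> 0"
  shows "norm (\<psi> t) < 1"
proof (rule ccontr)
  assume "\<not> norm (\<psi> t) < 1"
  with norm_\<psi>_le_1[of t] have norm: "norm (\<psi> t) = 1" by simp
  \<comment> \<open>A nonnegative function whose mean is one minus the squared modulus of
    \<open>\<psi> t\<close>, that is, zero.\<close>
  define f where "f k = 1 - Re (cnj (\<psi> t) * iexp (t * (real k - 1)))" for k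
  have norm1: "norm (cnj (\<psi> t) * iexp (t * (real k - 1))) = 1" for k
    using norm by (simp add: norm_mult del: of_real_diff of_real_mult)
  have f_nonneg: "0 \<le> f k" for k
    using complex_Re_le_cmod[of "cnj (\<psi> t) * iexp (t * (real k - 1))"] norm1[of k] by (simp add: f_def)
  have int: "integrable (measure_pmf \<xi>) (\<lambda>k. iexp (t * (real k - 1)))"
    by (intro measure_pmf.integrable_const_bound[where B=1]) (auto simp del: of_real_diff of_real_mult)
  have int': "integrable (measure_pmf \<xi>) (\<lambda>k. cnj (\<psi> t) * iexp (t * (real k - 1)))"
    using int by simp
  have "measure_pmf.expectation \<xi> f = 1 - Re (cnj (\<psi> t) * \<psi> t)"
    unfolding f_def using int int' by (simp add: integral_Re[OF int'] \<psi>_def del: of_real_diff of_real_mult times_complex.sel)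
  also have "\<dots> = 0"
    using norm complex_norm_square[of "\<psi> t"] by (simp add: mult.commute)
  finally have "AE k in measure_pmf \<xi>. f k = 0"
    using f_nonneg int' unfolding f_def
    by (subst integral_nonneg_eq_0_iff_AE[symmetric]) (auto simp del: of_real_diff of_real_mult times_complex.sel)
  then have *: "iexp (t * (real k - 1)) = \<psi> t" if "k \<in> set_pmf \<xi>" for k
  proof -
    let ?w = "cnj (\<psi> t) * iexp (t * (real k - 1))"
    have "Re ?w = 1" using that \<open>AE k in _. f k = 0\<close> by (auto simp: AE_measure_pmf_iff f_def)
    moreover have "(Re ?w)\<^sup>2 + (Im ?w)\<^sup>2 = 1" using norm1[of k] cmod_power2[of ?w] by simp
    ultimately have "?w = 1" by (simp only: complex_eq_iff) simp
    then have "\<psi> t * ?w = \<psi> t" by simp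
    moreover have "\<psi> t * cnj (\<psi> t) = 1" using norm complex_norm_square[of "\<psi> t"] by simp
    ultimately show ?thesis by (simp only: mult.assoc[symmetric] mult_1)
  qed
  define A where "A = {m :: nat. iexp (t * real m) = 1}"
  have supp: "set_pmf \<xi> \<subseteq> A"
  proof
    fix k assume k: "k \<in> set_pmf \<xi>"
    have "iexp (t * real k) = iexp (t * (real k - 1)) / iexp (t * (real 0 - 1))"
      by (simp add: exp_diff[symmetric] algebra_simps)
    also have "\<dots> = 1" using *[OF k] *[OF zero_in_support] norm by auto
    finally show "k \<in> A" by (simp add: A_def)
  qed
  obtain b where b: "b \<in> A" "0 < b" using supp ex_pos_in_support by blast
  define g where "g = (LEAST m. m \<in> A \<and> 0 < m)"
  have g: "g \<in> A" "0 < g" using LeastI[of "\<lambda>m. m \<in> A \<and> 0 < m" b] b by (auto simp: g_def)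
  have g_dvd: "g dvd m" if "m \<in> A" for m
  proof -
    have "iexp (t * real m) = iexp (t * real g) ^ (m div g) * iexp (t * real (m mod g))"
    proof -
      have "real m = real (m div g) * real g + real (m mod g)"
        by (metis div_mult_mod_eq of_nat_add of_nat_mult)
      then have "t * real m = real (m div g) * (t * real g) + t * real (m mod g)"
        by (simp only:) (simp add: algebra_simps)
      then show ?thesis
        by (simp only:) (simp add: exp_add[symmetric] exp_of_nat_mult[symmetric] algebra_simps)
    qed
    then have "m mod g \<in> A" using that g(1) by (simp add: A_def)
    then have "\<not> 0 < m mod g"
      using not_less_Least[of "m mod g" "\<lambda>m. m \<in> A \<and> 0 < m"] g(2) by (auto simp: g_def[symmetric])
    then show ?thesis by (simp add: mod_eq_0_iff_dvd)
  qed
  have "g dvd period" unfolding period_def using g_dvd supp by (intro Gcd_greatest) blast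
  then obtain l where l: "period = g * l" by (rule dvdE)
  have "iexp (t * real period) = iexp (t * real g) ^ l"
    unfolding l by (simp add: exp_of_nat_mult[symmetric] algebra_simps)
  also have "\<dots> = 1" using g(1) by (simp add: A_def)
  finally have "cos (t * real period) = 1"
    by (metis Re_exp Re_i_times Im_i_times Im_complex_of_real Re_complex_of_real exp_zero mult_1 neg_0_equal_iff_equal one_complex.sel(1))
  then obtain n :: int where n: "t * real period = of_int n * 2 * pi"
    using cos_one_2pi_int by blast
  have "\<bar>t * real period\<bar> \<le> pi"
    using t(1) period_pos by (simp add: abs_mult field_simps)
  then have "\<bar>of_int n :: real\<bar> * 2 * pi \<le> pi" unfolding n by (simp add: abs_mult)
  then have "\<bar>of_int n :: real\<bar> * 2 \<le> 1" using pi_gt_zero by (metis mult.commute mult.right_neutral mult_le_cancel_left_pos mult.assoc)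
  then have "n = 0" by linarith
  with n t(2) period_pos show False by simp
qed

text \<open>Near zero this is the quadratic expansion with half of its coefficient sacrificed to the
  error. On the compact remainder the modulus stays below \<open>1 - \<eta>\<close>, and \<eta> is
  converted into a Gaussian exponent using \<open>\<bar>t\<bar> \<le> pi / period\<close>.\<close>

lemma norm_\<psi>_gaussian:
  "\<exists>c>0. \<forall>t. \<bar>t\<bar> \<le> pi / period \<longrightarrow> norm (\<psi> t) \<le> exp (- c * t\<^sup>2)"
proof -
  obtain \<delta>0 where \<delta>0: "0 < \<delta>0" "\<And>t. \<bar>t\<bar> \<le> \<delta>0 \<Longrightarrow> norm (\<psi> t - (1 - t\<^sup>2 * sigma2 / 2)) \<le> sigma2 / 4 * t\<^sup>2"
    using \<psi>_quadratic[of "sigma2 / 4"] variance_pos by auto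
  \<comment> \<open>The second bound keeps the main term \<open>1 - t\<^sup>2 * sigma2 / 2\<close>
    nonnegative, so that it equals its modulus.\<close>
  define \<delta> where "\<delta> = min \<delta>0 (sqrt (2 / sigma2))"
  have \<delta>: "0 < \<delta>" using \<delta>0 variance_pos by (simp add: \<delta>_def)
  have near: "norm (\<psi> t) \<le> exp (- (sigma2 / 4) * t\<^sup>2)" if t: "\<bar>t\<bar> \<le> \<delta>" for t
  proof -
    have "t\<^sup>2 \<le> (sqrt (2 / sigma2))\<^sup>2"
      using t unfolding \<delta>_def by (metis abs_le_square_iff abs_of_nonneg min.boundedE norm_le_zero_iff power2_abs power_mono abs_ge_zero)
    also have "\<dots> = 2 / sigma2" using variance_pos by simp
    finally have "t\<^sup>2 * sigma2 / 2 \<le> 1" using variance_pos by (simp add: field_simps)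
    then have "norm (1 - complex_of_real (t\<^sup>2 * sigma2 / 2)) = 1 - t\<^sup>2 * sigma2 / 2"
      by (metis abs_of_nonneg diff_ge_0_iff_ge norm_of_real of_real_1 of_real_diff)
    moreover have "norm (\<psi> t) \<le> norm (\<psi> t - (1 - complex_of_real (t\<^sup>2 * sigma2 / 2))) + norm (1 - complex_of_real (t\<^sup>2 * sigma2 / 2))"
      using norm_triangle_ineq[of "\<psi> t - (1 - complex_of_real (t\<^sup>2 * sigma2 / 2))" "1 - complex_of_real (t\<^sup>2 * sigma2 / 2)"] by simp
    moreover have "norm (\<psi> t - (1 - complex_of_real (t\<^sup>2 * sigma2 / 2))) \<le> sigma2 / 4 * t\<^sup>2"
      using \<delta>0(2)[of t] t by (simp add: \<delta>_def)
    ultimately have "norm (\<psi> t) \<le> 1 + (- (sigma2 / 4) * t\<^sup>2)" by (simp add: algebra_simps)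
    also have "\<dots> \<le> exp (- (sigma2 / 4) * t\<^sup>2)" by (rule exp_ge_add_one_self)
    finally show ?thesis .
  qed
  define K where "K = {t. \<delta> \<le> \<bar>t\<bar> \<and> \<bar>t\<bar> \<le> pi / period}"
  have "\<exists>\<eta>>0. \<forall>t\<in>K. norm (\<psi> t) \<le> 1 - \<eta>"
  proof (cases "K = {}")
    case False
    have "compact K"
    proof -
      have "K = {- pi / period .. pi / period} \<inter> ({..- \<delta>} \<union> {\<delta>..})"
        using \<delta> by (auto simp: K_def)
      then show ?thesis by (auto intro!: compact_Int_closed)
    qed
    moreover have "continuous_on K (\<lambda>t. norm (\<psi> t))"
      using isCont_\<psi> by (intro continuous_on_norm continuous_at_imp_continuous_on) auto
    ultimately obtain s where s: "s \<in> K" "\<And>t. t \<in> K \<Longrightarrow> norm (\<psi> t) \<le> norm (\<psi> s)"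
      using continuous_attains_sup[of K "\<lambda>t. norm (\<psi> t)"] False by blast
    have "norm (\<psi> s) < 1" using s(1) \<delta> by (intro norm_\<psi>_less_1) (auto simp: K_def)
    with s(2) show ?thesis by (intro exI[of _ "1 - norm (\<psi> s)"]) auto
  qed (auto intro: exI[of _ 1])
  then obtain \<eta> where \<eta>: "0 < \<eta>" "\<And>t. t \<in> K \<Longrightarrow> norm (\<psi> t) \<le> 1 - \<eta>" by blast
  define c where "c = min (sigma2 / 4) (\<eta> / (pi / period)\<^sup>2)"
  have c: "0 < c" using variance_pos \<eta> period_pos by (simp add: c_def)
  have "norm (\<psi> t) \<le> exp (- c * t\<^sup>2)" if t: "\<bar>t\<bar> \<le> pi / period" for t
  proof (cases "\<bar>t\<bar> \<le> \<delta>")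
    case True
    have "c \<le> sigma2 / 4" unfolding c_def by (rule min.cobounded1)
    then have "c * t\<^sup>2 \<le> sigma2 / 4 * t\<^sup>2" by (intro mult_right_mono) auto
    then have "exp (- (sigma2 / 4) * t\<^sup>2) \<le> exp (- c * t\<^sup>2)" by simp
    with near[OF True] show ?thesis by linarith
  next
    case False
    then have "norm (\<psi> t) \<le> 1 + - \<eta>" using t \<eta>(2)[of t] by (simp add: K_def)
    also have "\<dots> \<le> exp (- \<eta>)" by (rule exp_ge_add_one_self)
    also have "c * t\<^sup>2 \<le> \<eta> / (pi / period)\<^sup>2 * (pi / period)\<^sup>2"
    proof (rule mult_mono)
      show "t\<^sup>2 \<le> (pi / real period)\<^sup>2" using power_mono[OF t, of 2] by simp
    qed (use \<eta> in \<open>auto simp: c_def\<close>)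
    then have "exp (- \<eta>) \<le> exp (- c * t\<^sup>2)" using period_pos by simp
    finally show ?thesis .
  qed
  with c show ?thesis by blast
qed

end

section \<open>Local limit bounds for sums of i.i.d. offspring numbers\<close>

lemma gaussian_integral:
  assumes "0 < c"
  shows "integrable lborel (\<lambda>x. exp (- c * x\<^sup>2))"
    and "(\<integral>x. exp (- c * x\<^sup>2) \<partial>lborel) = sqrt (pi / c)"
proof -
  let ?s = "sqrt (1 / (2 * c))"
  have eq: "exp (- c * x\<^sup>2) = sqrt (pi / c) * normal_density 0 ?s x" for x
    using assms by (simp add: normal_density_def real_sqrt_divide real_sqrt_mult field_simps)
  show "integrable lborel (\<lambda>x. exp (- c * x\<^sup>2))"
    unfolding eq using assms by (intro integrable_mult_right integrable_normal_density) simp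
  show "(\<integral>x. exp (- c * x\<^sup>2) \<partial>lborel) = sqrt (pi / c)"
    unfolding eq using assms by simp
qed

context critical_offspring
begin

lemma char_replicate:
  "measure_pmf.expectation (replicate_pmf n \<xi>) (\<lambda>x. iexp (t * (real (sum_list x) - real n))) = \<psi> t ^ n"
proof (induction n)
  case (Suc n)
  let ?f = "\<lambda>n x. iexp (t * (real (sum_list x) - real n))"
  have "replicate_pmf (Suc n) \<xi> = bind_pmf \<xi> (\<lambda>c. map_pmf ((#) c) (replicate_pmf n \<xi>))"
    by (simp add: map_pmf_def)
  then have "measure_pmf.expectation (replicate_pmf (Suc n) \<xi>) (?f (Suc n)) =
      measure_pmf.expectation \<xi> (\<lambda>c. measure_pmf.expectation (replicate_pmf n \<xi>) (\<lambda>x. ?f (Suc n) (c # x)))"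
    by (simp only: expectation_bind_pmf_bounded norm_exp_i_times order_refl integral_map_pmf)
  also have "\<dots> = measure_pmf.expectation \<xi> (\<lambda>c. iexp (t * (real c - 1)) * \<psi> t ^ n)"
  proof (intro Bochner_Integration.integral_cong refl)
    fix c
    have "?f (Suc n) (c # x) = iexp (t * (real c - 1)) * ?f n x" for x
      by (simp add: exp_add[symmetric] algebra_simps)
    then show "measure_pmf.expectation (replicate_pmf n \<xi>) (\<lambda>x. ?f (Suc n) (c # x)) =
        iexp (t * (real c - 1)) * \<psi> t ^ n"
      by (simp only: integral_mult_right_zero Suc)
  qed
  also have "\<dots> = \<psi> t ^ Suc n"
    by (simp only: integral_mult_left_zero \<psi>_def[symmetric] power_Suc)
  finally show ?case .
qed simp

lemma period_dvd_sum_list: "x \<in> set_pmf (replicate_pmf n \<xi>) \<Longrightarrow> period dvd sum_list x"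
proof -
  assume "x \<in> set_pmf (replicate_pmf n \<xi>)"
  then have "\<forall>k\<in>set x. period dvd k" by (auto simp: set_replicate_pmf intro: period_dvd)
  then show ?thesis by (induction x) auto
qed

lemma local_inversion:
  assumes "period dvd j"
  shows "complex_of_real (2 * pi / period * measure_pmf.prob (replicate_pmf n \<xi>) {x. sum_list x = j}) =
    (\<integral>t. indicator {-pi/period..pi/period} t *\<^sub>R (iexp (t * (real n - real j)) * \<psi> t ^ n) \<partial>lborel)"
proof -
  have "iexp (t * (real n - real j)) * \<psi> t ^ n =
      measure_pmf.expectation (replicate_pmf n \<xi>) (\<lambda>x. iexp (t * real_of_int (int (sum_list x) - int j)))" for t
  proof -
    have "iexp (t * (real n - real j)) * iexp (t * (real (sum_list x) - real n)) =
        iexp (t * real_of_int (int (sum_list x) - int j))" for x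
      by (simp add: exp_add[symmetric] algebra_simps)
    then show ?thesis
      by (simp only: char_replicate[symmetric] integral_mult_right_zero[symmetric])
  qed
  moreover have "{x. int (sum_list x) - int j = 0} = {x. sum_list x = j}" by auto
  moreover have "int period dvd int (sum_list x) - int j" if "x \<in> set_pmf (replicate_pmf n \<xi>)" for x
    using period_dvd_sum_list[OF that] assms by (intro dvd_diff) auto
  ultimately show ?thesis
    using pmf_Fourier_inversion[of period "replicate_pmf n \<xi>" "\<lambda>x. int (sum_list x) - int j"] period_pos
    by (simp only:)
qed

text \<open>In the inversion integral \<open>j\<close> occurs only in a factor of modulus one, so
  integrating the Gaussian bound gives an estimate uniform in \<open>j\<close>. Sums not divisible
  by \<open>period\<close> have probability zero.\<close>

lemma local_upper_bound:
  "\<exists>C>0. \<forall>n>0. \<forall>j. measure_pmf.prob (replicate_pmf n \<xi>) {x. sum_list x = j} \<le> C / sqrt (real n)"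
proof -
  obtain c where c: "0 < c" "\<And>t. \<bar>t\<bar> \<le> pi / period \<Longrightarrow> norm (\<psi> t) \<le> exp (- c * t\<^sup>2)"
    using norm_\<psi>_gaussian by blast
  define C where "C = period / (2 * pi) * sqrt (pi / c)"
  have C: "0 < C" using c period_pos by (simp add: C_def)
  have "measure_pmf.prob (replicate_pmf n \<xi>) {x. sum_list x = j} \<le> C / sqrt (real n)"
    if n: "0 < n" for n j
  proof (cases "period dvd j")
    case True
    let ?p = "measure_pmf.prob (replicate_pmf n \<xi>) {x. sum_list x = j}"
    let ?h = "\<lambda>t. indicator {-pi/period..pi/period} t *\<^sub>R (iexp (t * (real n - real j)) * \<psi> t ^ n)"
    have gauss: "integrable lborel (\<lambda>t. exp (- (c * n) * t\<^sup>2))"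
      using c n by (intro gaussian_integral) simp
    have bound: "norm (?h t) \<le> exp (- (c * n) * t\<^sup>2)" for t
    proof (cases "\<bar>t\<bar> \<le> pi / period")
      case True
      have "norm (\<psi> t) ^ n \<le> exp (- c * t\<^sup>2) ^ n" using c(2)[OF True] by (intro power_mono) auto
      also have "\<dots> = exp (- (c * n) * t\<^sup>2)" by (simp add: exp_of_nat_mult[symmetric] algebra_simps)
      finally show ?thesis
        by (auto simp: norm_mult norm_power split: split_indicator simp del: of_real_diff of_real_mult)
    qed (auto split: split_indicator)
    have int: "integrable lborel ?h"
      by (rule Bochner_Integration.integrable_bound[OF gauss]) (use bound in auto)
    have "2 * pi / period * ?p = norm (complex_of_real (2 * pi / period * ?p))"
      by (simp only: norm_of_real) simp
    also have "\<dots> \<le> (\<integral>t. norm (?h t) \<partial>lborel)"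
      unfolding local_inversion[OF True] by (rule integral_norm_bound)
    also have "\<dots> \<le> (\<integral>t. exp (- (c * n) * t\<^sup>2) \<partial>lborel)"
      using bound int gauss by (intro integral_mono integrable_norm)
    also have "\<dots> = sqrt (pi / (c * n))" using c n by (intro gaussian_integral) simp
    finally have "?p \<le> period / (2 * pi) * sqrt (pi / (c * n))"
      using period_pos by (simp add: field_simps)
    then show ?thesis by (simp add: C_def real_sqrt_divide real_sqrt_mult)
  next
    case False
    then have "measure_pmf.prob (replicate_pmf n \<xi>) {x. sum_list x = j} = 0"
      using period_dvd_sum_list by (auto simp: measure_pmf_zero_iff)
    then show ?thesis using C by simp
  qed
  with C show ?thesis by blast
qed

text \<open>For numbers in the unit disc, \<open>n\<close>-th powers differ by at most
  \<open>n\<close> times the difference of the bases. The expansion of \<psi> makes this at most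
  \<open>e * s\<^sup>2\<close> against the powers of \<open>w n\<close>, whose limit is
  known.\<close>

lemma \<psi>_power_limit:
  "(\<lambda>n. \<psi> (s / sqrt (real n)) ^ n) \<longlonglongrightarrow> complex_of_real (exp (- (sigma2 / 2) * s\<^sup>2))"
proof -
  define w where "w n = complex_of_real (1 + (- (sigma2 / 2) * s\<^sup>2) / real n)" for n :: nat
  have "(\<lambda>n. complex_of_real ((1 + (- (sigma2 / 2) * s\<^sup>2) / real n) ^ n)) \<longlonglongrightarrow>
      complex_of_real (exp (- (sigma2 / 2) * s\<^sup>2))"
    by (rule isCont_tendsto_compose [OF _ tendsto_exp_limit_sequentially]) auto
  then have w: "(\<lambda>n. w n ^ n) \<longlonglongrightarrow> complex_of_real (exp (- (sigma2 / 2) * s\<^sup>2))"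
    by (simp add: w_def)
  have "(\<lambda>n. \<psi> (s / sqrt (real n)) ^ n - w n ^ n) \<longlonglongrightarrow> 0"
  proof (rule LIMSEQ_I)
    fix r :: real assume r: "0 < r"
    define q where "q = s\<^sup>2 + 1"
    define e where "e = r / (2 * q)"
    have s1: "0 < q" by (simp add: q_def add_nonneg_pos)
    have e: "0 < e" using r s1 by (simp add: e_def)
    obtain \<delta> where \<delta>: "0 < \<delta>" "\<And>t. \<bar>t\<bar> \<le> \<delta> \<Longrightarrow> norm (\<psi> t - (1 - t\<^sup>2 * sigma2 / 2)) \<le> e * t\<^sup>2"
      using \<psi>_quadratic[OF e] by blast
    \<comment> \<open>The first summand places \<open>s / sqrt n\<close> within \<delta> of zero,
      the second keeps \<open>w n\<close> in the unit disc, and the third makes \<open>n\<close>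
      positive.\<close>
    obtain N :: nat where N: "s\<^sup>2 / \<delta>\<^sup>2 + sigma2 * s\<^sup>2 + 1 < real N"
      using reals_Archimedean2 by blast
    have "norm (\<psi> (s / sqrt (real n)) ^ n - w n ^ n - 0) < r" if n: "N \<le> n" for n
    proof -
      let ?t = "s / sqrt (real n)"
      have "0 \<le> s\<^sup>2 / \<delta>\<^sup>2" "0 \<le> sigma2 * s\<^sup>2" using variance_pos by auto
      with N n have n': "s\<^sup>2 / \<delta>\<^sup>2 \<le> real n" "sigma2 * s\<^sup>2 \<le> real n" "0 < real n"
        by (simp_all only: of_nat_le_iff[symmetric, where 'a=real])
      have t2: "?t\<^sup>2 = s\<^sup>2 / n" using n' by (simp add: power_divide)
      have "?t\<^sup>2 \<le> \<delta>\<^sup>2" unfolding t2 using n' \<delta>(1) by (simp add: field_simps)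
      then have "\<bar>?t\<bar> \<le> \<delta>" using \<delta>(1) abs_le_square_iff[of ?t \<delta>] by simp
      from \<delta>(2)[OF this] have diff: "norm (\<psi> ?t - w n) \<le> e * (s\<^sup>2 / n)"
        unfolding t2 w_def by (simp add: field_simps)
      have "norm (w n) \<le> 1"
        unfolding w_def norm_of_real using n' variance_pos
        by (intro abs_leI) (simp_all add: field_simps)
      then have "norm (\<psi> ?t ^ n - w n ^ n) \<le> n * norm (\<psi> ?t - w n)"
        using norm_\<psi>_le_1 by (intro norm_power_diff) auto
      also have "\<dots> \<le> n * (e * (s\<^sup>2 / n))" using diff by (intro mult_left_mono) auto
      also have "\<dots> = e * s\<^sup>2" using n' by simp
      also have "\<dots> \<le> e * q" using e by (simp add: q_def)
      also have "\<dots> < r" using r s1 by (simp add: e_def)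
      finally show ?thesis by simp
    qed
    then show "\<exists>N. \<forall>n\<ge>N. norm (\<psi> (s / sqrt (real n)) ^ n - w n ^ n - 0) < r" by blast
  qed
  from tendsto_add[OF this w] show ?thesis by simp
qed

text \<open>After the substitution \<open>t = s / sqrt n\<close> the inversion integral converges to
  a positive Gaussian integral, so it eventually exceeds half the limit. The divisibility condition
  confines the claim to sums in the lattice.\<close>

lemma local_lower_bound:
  "\<exists>c>0. \<forall>\<^sub>F n in sequentially. period dvd n - 1 \<longrightarrow>
     c / sqrt (real n) \<le> measure_pmf.prob (replicate_pmf n \<xi>) {x. 1 + sum_list x = n}"
proof -
  obtain c where c: "0 < c" "\<And>t. \<bar>t\<bar> \<le> pi / period \<Longrightarrow> norm (\<psi> t) \<le> exp (- c * t\<^sup>2)"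
    using norm_\<psi>_gaussian by blast
  \<comment> \<open>The rescaled integrand. Its factor \<open>iexp (s / sqrt n)\<close> stems from
    the target sum being \<open>n - 1\<close> rather than the mean \<open>n\<close>, and it tends to
    one.\<close>
  define g where "g n s = indicator {-pi/period..pi/period} (s / sqrt (real n)) *\<^sub>R
    (iexp (s / sqrt (real n)) * \<psi> (s / sqrt (real n)) ^ n)" for n s
  define I where "I n = (\<integral>s. g n s \<partial>lborel)" for n
  have "(\<lambda>n. \<integral>s. g (Suc n) s \<partial>lborel) \<longlonglongrightarrow> (\<integral>s. complex_of_real (exp (- (sigma2 / 2) * s\<^sup>2)) \<partial>lborel)"
  proof (rule integral_dominated_convergence[where w="\<lambda>s. exp (- c * s\<^sup>2)"])
    show "integrable lborel (\<lambda>s. exp (- c * s\<^sup>2))" using c by (intro gaussian_integral)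
    show "AE s in lborel. norm (g (Suc n) s) \<le> exp (- c * s\<^sup>2)" for n
    proof (rule AE_I2)
      fix s
      let ?t = "s / sqrt (real (Suc n))"
      show "norm (g (Suc n) s) \<le> exp (- c * s\<^sup>2)"
      proof (cases "\<bar>?t\<bar> \<le> pi / period")
        case True
        have "norm (\<psi> ?t) ^ Suc n \<le> exp (- c * ?t\<^sup>2) ^ Suc n"
          using c(2)[OF True] by (intro power_mono) auto
        also have "\<dots> = exp (real (Suc n) * (- c * ?t\<^sup>2))" by (rule exp_of_nat_mult[symmetric])
        also have "real (Suc n) * (- c * ?t\<^sup>2) = - c * s\<^sup>2" by (simp add: power_divide)
        finally show ?thesis
          unfolding g_def by (auto simp: norm_mult norm_power split: split_indicator simp del: of_real_divide power_Suc)
      qed (auto simp: g_def split: split_indicator)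
    qed
    show "AE s in lborel. (\<lambda>n. g (Suc n) s) \<longlonglongrightarrow> complex_of_real (exp (- (sigma2 / 2) * s\<^sup>2))"
    proof (rule AE_I2)
      fix s
      have t: "(\<lambda>n. s / sqrt (real n)) \<longlonglongrightarrow> 0"
        by (intro tendsto_divide_0[OF tendsto_const] filterlim_at_top_imp_at_infinity
            filterlim_compose[OF sqrt_at_top] filterlim_real_sequentially)
      have "(\<lambda>n. iexp (s / sqrt (real n))) \<longlonglongrightarrow> iexp 0"
        by (intro isCont_tendsto_compose[OF isCont_iexp] t)
      from tendsto_mult[OF this \<psi>_power_limit[of s]]
      have *: "(\<lambda>n. iexp (s / sqrt (real n)) * \<psi> (s / sqrt (real n)) ^ n) \<longlonglongrightarrow>
          complex_of_real (exp (- (sigma2 / 2) * s\<^sup>2))"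
        by simp
      have "\<forall>\<^sub>F n in sequentially. \<bar>s / sqrt (real n)\<bar> < pi / period"
        using tendsto_rabs_zero[OF t] period_pos by (intro order_tendstoD(2)) auto
      then have "\<forall>\<^sub>F n in sequentially. iexp (s / sqrt (real n)) * \<psi> (s / sqrt (real n)) ^ n = g n s"
      proof eventually_elim
        case (elim n)
        then have "s / sqrt (real n) \<in> {-pi/period..pi/period}"
          by (simp add: abs_less_iff del: abs_divide)
        then show ?case by (simp only: g_def indicator_simps scaleR_one)
      qed
      from Lim_transform_eventually[OF * this]
      show "(\<lambda>n. g (Suc n) s) \<longlonglongrightarrow> complex_of_real (exp (- (sigma2 / 2) * s\<^sup>2))"
        by (rule LIMSEQ_Suc)
    qed
  qed (simp_all add: g_def)
  also have "(\<integral>s. complex_of_real (exp (- (sigma2 / 2) * s\<^sup>2)) \<partial>lborel) = complex_of_real (sqrt (2 * pi / sigma2))"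
    using gaussian_integral[of "sigma2 / 2"] variance_pos by (simp only: integral_complex_of_real) (simp add: mult.commute)
  finally have I: "I \<longlonglongrightarrow> complex_of_real (sqrt (2 * pi / sigma2))"
    unfolding I_def by (rule LIMSEQ_imp_Suc)
  define L where "L = sqrt (2 * pi / sigma2)"
  have L: "0 < L" using variance_pos by (simp add: L_def)
  have "(\<lambda>n. norm (I n)) \<longlonglongrightarrow> L" using tendsto_norm[OF I] L by (simp add: L_def)
  then have "\<forall>\<^sub>F n in sequentially. L / 2 < norm (I n)" using L by (intro order_tendstoD(1)) auto
  moreover have "\<forall>\<^sub>F n in sequentially. 0 < n" by (rule eventually_gt_at_top)
  ultimately have "\<forall>\<^sub>F n in sequentially. period dvd n - 1 \<longrightarrow>
     (period / (2 * pi) * (L / 2)) / sqrt (real n) \<le> measure_pmf.prob (replicate_pmf n \<xi>) {x. 1 + sum_list x = n}"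
  proof eventually_elim
    case (elim n)
    show ?case
    proof
      assume dvd: "period dvd n - 1"
      let ?p = "measure_pmf.prob (replicate_pmf n \<xi>) {x. sum_list x = n - 1}"
      have "complex_of_real (2 * pi / period * ?p) =
          (\<integral>t. indicator {-pi/period..pi/period} t *\<^sub>R (iexp t * \<psi> t ^ n) \<partial>lborel)"
        using local_inversion[OF dvd, of n] elim(2) by (simp add: of_nat_diff)
      also have "\<dots> = \<bar>1 / sqrt (real n)\<bar> *\<^sub>R (\<integral>s. indicator {-pi/period..pi/period} (0 + 1 / sqrt (real n) * s) *\<^sub>R
          (iexp (0 + 1 / sqrt (real n) * s) * \<psi> (0 + 1 / sqrt (real n) * s) ^ n) \<partial>lborel)"
        using elim(2) by (intro lborel_integral_real_affine) simp
      also have "\<dots> = (1 / sqrt (real n)) *\<^sub>R I n"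
        by (simp add: I_def g_def)
      finally have "norm (complex_of_real (2 * pi / period * ?p)) = norm ((1 / sqrt (real n)) *\<^sub>R I n)"
        by (rule arg_cong)
      then have "2 * pi / period * ?p = norm (I n) / sqrt (real n)"
        by (simp only: norm_of_real norm_scaleR) simp
      moreover have "?p = period / (2 * pi) * (2 * pi / period * ?p)"
        using period_pos by simp
      ultimately have "?p = period / (2 * pi) * norm (I n) / sqrt (real n)"
        by (metis times_divide_eq_right)
      also have "\<dots> \<ge> period / (2 * pi) * (L / 2) / sqrt (real n)"
        using elim(1) by (intro divide_right_mono mult_left_mono) auto
      also have "{x. sum_list x = n - 1} = {x. 1 + sum_list x = n}" using elim(2) by auto
      finally show "(period / (2 * pi) * (L / 2)) / sqrt (real n) \<le>
          measure_pmf.prob (replicate_pmf n \<xi>) {x. 1 + sum_list x = n}" .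
    qed
  qed
  moreover have "0 < period / (2 * pi) * (L / 2)" using L period_pos by simp
  ultimately show ?thesis by blast
qed

end

section \<open>Fringe subtrees of conditioned Galton-Watson trees\<close>

definition below :: "nat \<Rightarrow> nat list list \<Rightarrow> nat" where
  "below r us = length (filter (\<lambda>u. length u < r) us)"

section \<open>Rotation invariance and sums over fringe subtrees\<close>

lemma map_rotate1_replicate_pmf: "map_pmf rotate1 (replicate_pmf n p) = replicate_pmf n p"
proof (cases n)
  case (Suc m)
  have "map_pmf rotate1 (replicate_pmf (Suc m) p) =
      do {x \<leftarrow> p; xs \<leftarrow> replicate_pmf m p; return_pmf (xs @ [x])}"
    by (simp add: map_bind_pmf)
  also have "\<dots> = do {xs \<leftarrow> replicate_pmf m p; x \<leftarrow> p; return_pmf (xs @ [x])}"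
    by (rule bind_commute_pmf)
  also have "\<dots> = replicate_pmf (m + 1) p"
    unfolding replicate_pmf_distrib replicate_pmf_1 by (simp add: bind_map_pmf)
  finally show ?thesis using Suc by simp
qed simp

lemma map_rotate_replicate_pmf: "map_pmf (rotate i) (replicate_pmf n p) = replicate_pmf n p"
proof (induction i)
  case (Suc i)
  have "rotate (Suc i) = rotate1 \<circ> rotate i" by (simp add: fun_eq_iff)
  then have "map_pmf (rotate (Suc i)) (replicate_pmf n p) = map_pmf rotate1 (map_pmf (rotate i) (replicate_pmf n p))"
    by (metis pmf.map_comp)
  then show ?case using Suc map_rotate1_replicate_pmf by metis
qed (simp add: rotate0)

lemma length_replicate_pmf: "x \<in> set_pmf (replicate_pmf n p) \<Longrightarrow> length x = n"
  by (simp add: set_replicate_pmf)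

text \<open>
  By \<open>subtree_word\<close>, the word \<open>rotate i x\<close> begins with the word of the subtree rooted at the
  \<open>i\<close>-th vertex, so for suitable \<open>F\<close> the left-hand side is a sum over all fringe subtrees.
\<close>

lemma nn_integral_rotations:
  fixes F :: "nat list \<Rightarrow> ennreal"
  shows "(\<integral>\<^sup>+x. indicator (tree_words n) x * (\<Sum>i<n. F (rotate i x)) \<partial>replicate_pmf n p) =
    (\<integral>\<^sup>+y. indicator {y. 1 + sum_list y = n} y * F y \<partial>replicate_pmf n p)"
proof -
  let ?R = "measure_pmf (replicate_pmf n p)"
  \<comment> \<open>The exponent of the inverse rotation; the reduction modulo \<open>n\<close>
    keeps the index \<open>0\<close> in range.\<close>
  define s where "s i = (n - i) mod n" for i
  have s: "s i < n" "s (s i) = i" if "i < n" for i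
  proof -
    show "s i < n" using that by (simp add: s_def)
    show "s (s i) = i" using that by (cases "i = 0") (auto simp: s_def)
  qed
  \<comment> \<open>By the cycle lemma the indicator of the sum is the number of rotations that are
    tree words. Invariance of the law then shifts each rotation from the indicator to
    \<open>F\<close>.\<close>
  have "(\<integral>\<^sup>+y. indicator {y. 1 + sum_list y = n} y * F y \<partial>?R) =
      (\<integral>\<^sup>+y. (\<Sum>i<n. indicator (tree_words n) (rotate i y) * F y) \<partial>?R)"
  proof (rule nn_integral_cong_AE, rule AE_pmfI)
    fix y assume "y \<in> set_pmf (replicate_pmf n p)"
    then have len: "length y = n" by (rule length_replicate_pmf)
    have "(\<Sum>i<n. indicator (tree_words n) (rotate i y) * F y) =
        (\<Sum>i<n. indicator {i. rotate i y \<in> tree_words n} i) * F y"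
      by (simp add: sum_distrib_right indicator_def)
    also have "(\<Sum>i<n. indicator {i. rotate i y \<in> tree_words n} i :: ennreal) =
        of_nat (card {i. i < n \<and> rotate i y \<in> tree_words n})"
      by (simp add: indicator_def of_bool_def sum.If_cases Int_def)
    also have "\<dots> = indicator {y. 1 + sum_list y = n} y"
      unfolding cycle_lemma[OF len] by (simp add: indicator_def)
    finally show "indicator {y. 1 + sum_list y = n} y * F y =
        (\<Sum>i<n. indicator (tree_words n) (rotate i y) * F y)" by simp
  qed
  also have "\<dots> = (\<Sum>i<n. \<integral>\<^sup>+y. indicator (tree_words n) (rotate i y) * F y \<partial>?R)"
    by (rule nn_integral_sum) simp
  also have "\<dots> = (\<Sum>i<n. \<integral>\<^sup>+x. indicator (tree_words n) x * F (rotate (s i) x) \<partial>?R)"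
  proof (intro sum.cong refl)
    fix i assume i: "i \<in> {..<n}"
    have "(\<integral>\<^sup>+y. indicator (tree_words n) (rotate i y) * F y \<partial>?R) =
        (\<integral>\<^sup>+y. indicator (tree_words n) (rotate i y) * F y \<partial>measure_pmf (map_pmf (rotate (s i)) (replicate_pmf n p)))"
      by (simp only: map_rotate_replicate_pmf)
    also have "\<dots> = (\<integral>\<^sup>+x. indicator (tree_words n) (rotate i (rotate (s i) x)) * F (rotate (s i) x) \<partial>?R)"
      by (simp only: nn_integral_map_pmf)
    also have "\<dots> = (\<integral>\<^sup>+x. indicator (tree_words n) x * F (rotate (s i) x) \<partial>?R)"
    proof (rule nn_integral_cong_AE, rule AE_pmfI)
      fix x assume "x \<in> set_pmf (replicate_pmf n p)"
      then have len: "length x = n" by (rule length_replicate_pmf)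
      have "(i + s i) mod n = 0" using i by (cases "i = 0") (auto simp: s_def)
      then have "rotate (i + s i) x = x" using len by (metis rotate_conv_mod rotate0 id_apply)
      then show "indicator (tree_words n) (rotate i (rotate (s i) x)) * F (rotate (s i) x) =
          indicator (tree_words n) x * F (rotate (s i) x)" by (simp add: rotate_rotate)
    qed
    finally show "(\<integral>\<^sup>+y. indicator (tree_words n) (rotate i y) * F y \<partial>?R) =
        (\<integral>\<^sup>+x. indicator (tree_words n) x * F (rotate (s i) x) \<partial>?R)" .
  qed
  also have "\<dots> = (\<Sum>i<n. \<integral>\<^sup>+x. indicator (tree_words n) x * F (rotate i x) \<partial>?R)"
    by (rule sum.reindex_bij_witness[of _ s s]) (use s in auto)
  also have "\<dots> = (\<integral>\<^sup>+x. (\<Sum>i<n. indicator (tree_words n) x * F (rotate i x)) \<partial>?R)"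
    by (rule nn_integral_sum[symmetric]) simp
  finally show ?thesis by (simp only: sum_distrib_left)
qed

section \<open>Moment and survival estimates for the unconditioned tree\<close>

context critical_offspring
begin

text \<open>One visit in the moment recursion: each of the \<open>c\<close> children contributes
  mean \<open>j\<close> and variance \<open>v\<close>. Averaging replaces \<open>c\<close> by its
  mean one, and the randomness of \<open>c\<close> adds \<open>sigma2 * j\<^sup>2\<close>.\<close>

lemma nn_integral_quadratic:
  assumes "0 \<le> B" "0 \<le> j" "0 \<le> v" "0 \<le> V"
  shows "(\<integral>\<^sup>+c. ennreal ((B + real c * j)\<^sup>2 + real c * v + V) \<partial>measure_pmf \<xi>) =
    ennreal ((B + j)\<^sup>2 + sigma2 * j\<^sup>2 + v + V)"
proof -
  have eq: "(B + real c * j)\<^sup>2 + real c * v + V =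
      (B\<^sup>2 + V) + (2 * B * j + v) * real c + j\<^sup>2 * (real c)\<^sup>2" for c
    by (simp add: power2_eq_square algebra_simps)
  have sq: "measure_pmf.expectation \<xi> (\<lambda>c. (real c)\<^sup>2) = sigma2 + 1"
    using measure_pmf.variance_eq[OF integrable_id integrable_square] mean by simp
  have int: "integrable (measure_pmf \<xi>) (\<lambda>c. (B\<^sup>2 + V) + (2 * B * j + v) * real c + j\<^sup>2 * (real c)\<^sup>2)"
    using integrable_id integrable_square by simp
  have "(\<integral>\<^sup>+c. ennreal ((B + real c * j)\<^sup>2 + real c * v + V) \<partial>measure_pmf \<xi>) =
      ennreal (measure_pmf.expectation \<xi> (\<lambda>c. (B + real c * j)\<^sup>2 + real c * v + V))"
    using int assms unfolding eq[symmetric] by (intro nn_integral_eq_integral) auto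
  also have "measure_pmf.expectation \<xi> (\<lambda>c. (B + real c * j)\<^sup>2 + real c * v + V) =
      (B\<^sup>2 + V) + (2 * B * j + v) * 1 + j\<^sup>2 * (sigma2 + 1)"
    unfolding eq using integrable_id integrable_square by (simp add: sq mean del: measure_pmf.variance_eq)
  also have "\<dots> = (B + j)\<^sup>2 + sigma2 * j\<^sup>2 + v + V"
    by (simp add: power2_eq_square algebra_simps)
  finally show ?thesis .
qed

lemma replicate_pmf_Suc_map: "replicate_pmf (Suc n) p = bind_pmf p (\<lambda>c. map_pmf ((#) c) (replicate_pmf n p))"
  by (simp add: map_pmf_def)

text \<open>
  A pending vertex with \<open>j\<close> levels to go contributes independently of the others, with mean at
  most \<open>j\<close> and variance at most \<open>sigma2 * j ^ 3\<close>.
\<close>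

lemma second_moment_below_stack:
  assumes "0 \<le> a"
  shows "(\<integral>\<^sup>+x. ennreal ((a + real (below r (visit st x)))\<^sup>2) \<partial>replicate_pmf h \<xi>) \<le>
    ennreal ((a + (\<Sum>u\<leftarrow>st. real (r - length u)))\<^sup>2 + (\<Sum>u\<leftarrow>st. sigma2 * real (r - length u) ^ 3))"
  using assms
proof (induction h arbitrary: a st)
  case 0
  have "0 \<le> (\<Sum>u\<leftarrow>st. sigma2 * real (r - length u) ^ 3)"
    using variance_pos by (intro sum_list_nonneg) auto
  moreover have "a\<^sup>2 \<le> (a + (\<Sum>u\<leftarrow>st. real (r - length u)))\<^sup>2"
    using 0 by (intro power_mono) (auto intro!: sum_list_nonneg)
  ultimately have "ennreal (a\<^sup>2) \<le>
      ennreal ((a + (\<Sum>u\<leftarrow>st. real (r - length u)))\<^sup>2 + (\<Sum>u\<leftarrow>st. sigma2 * real (r - length u) ^ 3))"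
    by (intro ennreal_leI) linarith
  then show ?case by (simp add: below_def del: ennreal_plus)
next
  case (Suc h)
  show ?case
  proof (cases st)
    case Nil
    then show ?thesis by (simp add: below_def measure_pmf.emeasure_space_1)
  next
    case (Cons u us)
    define j where "j = real (r - Suc (length u))"
    \<comment> \<open>\<open>a\<close> accumulates the vertices already counted; the top of the
      stack joins them if it lies in the first \<open>r\<close> levels.\<close>
    define a' where "a' = (if length u < r then a + 1 else a)"
    define S where "S = (\<Sum>u\<leftarrow>us. real (r - length u))"
    define V where "V = (\<Sum>u\<leftarrow>us. sigma2 * real (r - length u) ^ 3)"
    have nonneg: "0 \<le> j" "0 \<le> a'" "0 \<le> S" "0 \<le> V"
      using Suc.prems variance_pos by (auto simp: j_def a'_def S_def V_def intro!: sum_list_nonneg)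
    have children: "(\<Sum>v\<leftarrow>map (\<lambda>i. u @ [i]) [0..<c] @ us. real (r - length v)) = real c * j + S"
      "(\<Sum>v\<leftarrow>map (\<lambda>i. u @ [i]) [0..<c] @ us. sigma2 * real (r - length v) ^ 3) = real c * (sigma2 * j ^ 3) + V" for c
      by (simp_all add: comp_def sum_list_triv j_def S_def V_def)
    have "(\<integral>\<^sup>+x. ennreal ((a + real (below r (visit st x)))\<^sup>2) \<partial>replicate_pmf (Suc h) \<xi>) =
        (\<integral>\<^sup>+c. \<integral>\<^sup>+x. ennreal ((a' + real (below r (visit (map (\<lambda>i. u @ [i]) [0..<c] @ us) x)))\<^sup>2)
          \<partial>replicate_pmf h \<xi> \<partial>\<xi>)"
      unfolding replicate_pmf_Suc_map nn_integral_bind_pmf nn_integral_map_pmf Cons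
      by (intro nn_integral_cong) (simp add: below_def a'_def add_ac)
    also have "\<dots> \<le> (\<integral>\<^sup>+c. ennreal (((a' + S) + real c * j)\<^sup>2 + real c * (sigma2 * j ^ 3) + V) \<partial>\<xi>)"
    proof (rule nn_integral_mono)
      fix c
      show "(\<integral>\<^sup>+x. ennreal ((a' + real (below r (visit (map (\<lambda>i. u @ [i]) [0..<c] @ us) x)))\<^sup>2) \<partial>replicate_pmf h \<xi>)
          \<le> ennreal (((a' + S) + real c * j)\<^sup>2 + real c * (sigma2 * j ^ 3) + V)"
        using Suc.IH[OF nonneg(2), of "map (\<lambda>i. u @ [i]) [0..<c] @ us"] unfolding children
        by (simp only: add_ac)
    qed
    also have "\<dots> = ennreal (((a' + S) + j)\<^sup>2 + sigma2 * j\<^sup>2 + sigma2 * j ^ 3 + V)"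
      using nonneg variance_pos by (intro nn_integral_quadratic) auto
    also have "\<dots> \<le> ennreal ((a + (\<Sum>u\<leftarrow>st. real (r - length u)))\<^sup>2 + (\<Sum>u\<leftarrow>st. sigma2 * real (r - length u) ^ 3))"
    proof (rule ennreal_leI)
      have sums: "(\<Sum>u\<leftarrow>st. real (r - length u)) = real (r - length u) + S"
        "(\<Sum>u\<leftarrow>st. sigma2 * real (r - length u) ^ 3) = sigma2 * real (r - length u) ^ 3 + V"
        by (simp_all add: Cons S_def V_def)
      show "((a' + S) + j)\<^sup>2 + sigma2 * j\<^sup>2 + sigma2 * j ^ 3 + V \<le>
          (a + (\<Sum>u\<leftarrow>st. real (r - length u)))\<^sup>2 + (\<Sum>u\<leftarrow>st. sigma2 * real (r - length u) ^ 3)"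
      proof (cases "length u < r")
        case True
        then have r: "real (r - length u) = j + 1" by (simp add: j_def of_nat_diff)
        \<comment> \<open>The term \<open>j\<^sup>2\<close> comes from the random number of children
          and \<open>j ^ 3\<close> from their own variances; one more level in the cubic bound
          absorbs both.\<close>
        have "j\<^sup>2 + j ^ 3 \<le> (j + 1) ^ 3"
          using nonneg by (simp add: power3_eq_cube power2_eq_square algebra_simps)
        then have "sigma2 * (j\<^sup>2 + j ^ 3) \<le> sigma2 * (j + 1) ^ 3"
          using variance_pos by (intro mult_left_mono) auto
        then show ?thesis unfolding sums r using True by (simp add: a'_def algebra_simps)
      next
        case False
        then have "j = 0" "real (r - length u) = 0" by (auto simp: j_def)
        then show ?thesis unfolding sums using False by (simp add: a'_def)
      qed
    qed
    finally show ?thesis .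
  qed
qed

lemma second_moment_below:
  "(\<integral>\<^sup>+x. ennreal ((real (below r (visit [[]] x)))\<^sup>2) \<partial>replicate_pmf h \<xi>) \<le>
    ennreal ((1 + sigma2) * real r ^ 3)"
proof -
  have "real r ^ 2 \<le> real r ^ 3" by (cases r) (auto intro!: power_increasing)
  then have "(0 + (\<Sum>u\<leftarrow>[[] :: nat list]. real (r - length u)))\<^sup>2 +
      (\<Sum>u\<leftarrow>[[] :: nat list]. sigma2 * real (r - length u) ^ 3) \<le> (1 + sigma2) * real r ^ 3"
    by (simp add: algebra_simps)
  then show ?thesis
    using order_trans[OF second_moment_below_stack[OF order_refl, where r=r and st="[[]]" and h=h] ennreal_leI]
    by simp
qed

text \<open>In the survival recursion this replaces the variance as a quantitative measure of
  branching.\<close>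

definition branch_prob :: real where
  "branch_prob = measure_pmf.prob \<xi> {k. 2 \<le> k}"

lemma branch_prob_bounds: "0 < branch_prob" "branch_prob \<le> 1"
proof -
  show "branch_prob \<le> 1" by (simp add: branch_prob_def)
  have "branch_prob \<noteq> 0"
  proof
    assume "branch_prob = 0"
    then have "\<forall>k\<in>set_pmf \<xi>. k \<le> 1"
      unfolding branch_prob_def measure_pmf_zero_iff by fastforce
    then have nonneg: "AE k in measure_pmf \<xi>. 0 \<le> 1 - real k" by (auto simp: AE_measure_pmf_iff)
    have int: "integrable (measure_pmf \<xi>) (\<lambda>k. 1 - real k)" using integrable_id by simp
    have "measure_pmf.expectation \<xi> (\<lambda>k. 1 - real k) = 0" using integrable_id mean by simp
    with integral_nonneg_eq_0_iff_AE[OF int nonneg] have "AE k in measure_pmf \<xi>. 1 - real k = 0" by simp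
    then show False using zero_in_support by (auto simp: AE_measure_pmf_iff)
  qed
  then show "0 < branch_prob" by (simp add: branch_prob_def zero_less_measure_iff)
qed

text \<open>Bernoulli's inequality with a quadratic gain, which is an equality for
  \<open>k = 2\<close>. Every further factor \<open>1 - q\<close> costs at most \<open>q\<close>, so
  the gain persists.\<close>

lemma one_minus_power_ge:
  fixes q :: real
  assumes "0 \<le> q" "q \<le> 1"
  shows "1 - real k * q + q\<^sup>2 * indicator {k. 2 \<le> k} k \<le> (1 - q) ^ k"
proof (induction k)
  case (Suc k)
  show ?case
  proof (cases "k = 0 \<or> k = 1")
    case True
    then show ?thesis by (auto simp: power2_eq_square algebra_simps)
  next
    case False
    then have "2 \<le> k" by simp
    have "(1 - q) ^ k \<le> 1" using assms by (intro power_le_one) auto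
    then have "q * (1 - q) ^ k \<le> q" using assms mult_left_le by blast
    then show ?thesis using Suc \<open>2 \<le> k\<close> by (simp add: algebra_simps)
  qed
qed simp

text \<open>Not the survival probability itself but an explicit upper bound of order
  \<open>1 / j\<close>, equal to one at \<open>j = 0\<close> and compatible with the recursion over
  generations.\<close>

definition survival :: "nat \<Rightarrow> real" where
  "survival j = 1 / (1 + branch_prob * real j)"

lemma survival_bounds: "0 < survival j" "survival j \<le> 1"
  using branch_prob_bounds by (auto simp: survival_def add_pos_nonneg divide_le_eq)

lemma integrable_power: "0 \<le> s \<Longrightarrow> s \<le> 1 \<Longrightarrow> integrable (measure_pmf \<xi>) (\<lambda>k. s ^ k)" for s :: real
  by (intro measure_pmf.integrable_const_bound[where B=1]) (auto intro: power_le_one)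

text \<open>Taking expectations in \<open>one_minus_power_ge\<close> leaves
  \<open>q - q\<^sup>2 * branch_prob\<close> to be bounded by the next value. With
  \<open>q = 1 / t\<close> and \<open>c\<close> for \<open>branch_prob\<close>, this amounts to
  \<open>(t - c) * (t + c) \<le> t\<^sup>2\<close>.\<close>

lemma survival_recursion:
  "1 - survival (Suc j) \<le> measure_pmf.expectation \<xi> (\<lambda>k. (1 - survival j) ^ k)"
proof -
  let ?q = "survival j" and ?c = branch_prob
  have ind: "integrable (measure_pmf \<xi>) (indicat_real {k. 2 \<le> k})"
    by (intro measure_pmf.integrable_const_bound[where B=1]) auto
  have int: "integrable (measure_pmf \<xi>) (\<lambda>k. 1 - real k * ?q + ?q\<^sup>2 * indicator {k. 2 \<le> k} k)"
    using integrable_id ind by simp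
  have "measure_pmf.expectation \<xi> (\<lambda>k. 1 - real k * ?q + ?q\<^sup>2 * indicator {k. 2 \<le> k} k) = 1 - ?q + ?q\<^sup>2 * ?c"
    using integrable_id ind by (simp add: mean branch_prob_def)
  moreover have "measure_pmf.expectation \<xi> (\<lambda>k. 1 - real k * ?q + ?q\<^sup>2 * indicator {k. 2 \<le> k} k) \<le>
      measure_pmf.expectation \<xi> (\<lambda>k. (1 - ?q) ^ k)"
    using survival_bounds[of j] by (intro integral_mono int integrable_power one_minus_power_ge) auto
  moreover have "?q - ?q\<^sup>2 * ?c \<le> survival (Suc j)"
  proof -
    define t where "t = 1 + ?c * real j"
    have t: "1 \<le> t" "0 < ?c" using branch_prob_bounds by (auto simp: t_def)
    have "(1 / t - (1 / t)\<^sup>2 * ?c) * (t\<^sup>2 * (t + ?c)) = (t - ?c) * (t + ?c)"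
      using t by (simp add: power2_eq_square field_simps)
    also have "\<dots> \<le> t\<^sup>2" using t by (simp add: power2_eq_square algebra_simps)
    also have "\<dots> = 1 / (t + ?c) * (t\<^sup>2 * (t + ?c))" using t by simp
    finally have "1 / t - (1 / t)\<^sup>2 * ?c \<le> 1 / (t + ?c)"
      using t by (subst (asm) mult_le_cancel_right_pos) auto
    then show ?thesis by (simp add: survival_def t_def algebra_simps)
  qed
  ultimately show ?thesis by linarith
qed

text \<open>Stack entries fail to reach level \<open>r\<close> independently, hence the product. An
  entry already at level \<open>r\<close> has \<open>survival 0 = 1\<close>, which makes the product
  zero and the bound one. Reading only \<open>h\<close> letters can only shrink the event.\<close>

lemma reach_stack:
  "(\<integral>\<^sup>+x. indicator {x. \<exists>u\<in>set (visit st x). r \<le> length u} x \<partial>replicate_pmf h \<xi>) \<le>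
    ennreal (1 - (\<Prod>u\<leftarrow>st. 1 - survival (r - length u)))"
proof (induction h arbitrary: st)
  case 0
  then show ?case by simp
next
  case (Suc h)
  show ?case
  proof (cases st)
    case Nil
    then show ?thesis by simp
  next
    case (Cons u us)
    let ?P = "\<Prod>u\<leftarrow>us. 1 - survival (r - length u)"
    show ?thesis
    proof (cases "r \<le> length u")
      case True
      then have "(\<Prod>u\<leftarrow>st. 1 - survival (r - length u)) = 0" by (simp add: Cons survival_def)
      moreover have "(\<integral>\<^sup>+x. indicator {x. \<exists>u\<in>set (visit st x). r \<le> length u} x \<partial>replicate_pmf (Suc h) \<xi>) \<le>
          (\<integral>\<^sup>+x. 1 \<partial>replicate_pmf (Suc h) \<xi>)"
        by (intro nn_integral_mono) (simp add: indicator_def)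
      ultimately show ?thesis by (simp add: measure_pmf.emeasure_space_1)
    next
      case False
      define j where "j = r - Suc (length u)"
      have r: "r - length u = Suc j" using False by (simp add: j_def)
      have P: "0 \<le> ?P" "?P \<le> 1"
      proof -
        show "0 \<le> ?P" using survival_bounds(2) by (intro prod_list_nonneg) auto
        have "0 \<le> x \<and> x \<le> 1" if "x \<in> set (map (\<lambda>u. 1 - survival (r - length u)) us)" for x
          using that survival_bounds by (auto simp: less_imp_le)
        then show "?P \<le> 1"
          by (induction us) (auto intro!: mult_le_one prod_list_nonneg)
      qed
      have pow: "0 \<le> (1 - survival j) ^ c" "(1 - survival j) ^ c \<le> 1" for c
        using survival_bounds[of j] by (auto intro: power_le_one)
      have int: "integrable (measure_pmf \<xi>) (\<lambda>c. (1 - survival j) ^ c)"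
        using survival_bounds[of j] by (intro integrable_power) auto
      have children: "(\<Prod>v\<leftarrow>map (\<lambda>i. u @ [i]) [0..<c] @ us. 1 - survival (r - length v)) =
          (1 - survival j) ^ c * ?P" for c
        by (simp add: comp_def j_def map_replicate_const prod_list_replicate)
      have "(\<integral>\<^sup>+x. indicator {x. \<exists>u\<in>set (visit st x). r \<le> length u} x \<partial>replicate_pmf (Suc h) \<xi>) =
          (\<integral>\<^sup>+c. \<integral>\<^sup>+x. indicator {x. \<exists>v\<in>set (visit (map (\<lambda>i. u @ [i]) [0..<c] @ us) x). r \<le> length v} x
            \<partial>replicate_pmf h \<xi> \<partial>\<xi>)"
        unfolding replicate_pmf_Suc_map nn_integral_bind_pmf nn_integral_map_pmf Cons
        using False by (intro nn_integral_cong) (simp add: indicator_def)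
      also have "\<dots> \<le> (\<integral>\<^sup>+c. ennreal (1 - (1 - survival j) ^ c * ?P) \<partial>\<xi>)"
        using Suc.IH unfolding children[symmetric] by (intro nn_integral_mono)
      also have "\<dots> = ennreal (measure_pmf.expectation \<xi> (\<lambda>c. 1 - (1 - survival j) ^ c * ?P))"
        using int pow P by (intro nn_integral_eq_integral) (auto intro: mult_le_one)
      also have "measure_pmf.expectation \<xi> (\<lambda>c. 1 - (1 - survival j) ^ c * ?P) =
          1 - measure_pmf.expectation \<xi> (\<lambda>c. (1 - survival j) ^ c) * ?P"
        using int by simp
      also have "ennreal \<dots> \<le> ennreal (1 - (\<Prod>u\<leftarrow>st. 1 - survival (r - length u)))"
        using mult_right_mono[OF survival_recursion[of j] P(1)] by (intro ennreal_leI) (simp add: Cons r)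
      finally show ?thesis .
    qed
  qed
qed

lemma reach_probability:
  "(\<integral>\<^sup>+x. indicator {x. \<exists>u\<in>set (visit [[]] x). r \<le> length u} x \<partial>replicate_pmf h \<xi>) \<le>
    ennreal (survival r)"
  using reach_stack[where st="[[]]" and r=r and h=h] by simp

end

section \<open>Tree functionals read off from truncated rotations\<close>

lemma rooted_tree_word: "x \<in> tree_words n \<Longrightarrow> rooted (set (visit [[]] x))"
  using tree_word_tree unfolding rooted_def by blast

text \<open>In depth-first order a subtree is a contiguous block. The vertex at position
  \<open>q\<close> of the subtree has position \<open>i + q\<close> in the tree, so truncating the
  tree at \<open>h\<close> discards at least what truncating the subtree at \<open>h\<close>
  does.\<close>

lemma subtree_take:
  assumes x: "x \<in> tree_words n" and i: "i < n"
    and z: "visit [[]] x ! i @ z \<in> set (take h (visit [[]] x))"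
  shows "z \<in> set (take h (visit [[]] (rotate i x)))"
proof -
  let ?vs = "visit [[]] x" and ?V = "visit [[]] (rotate i x)"
  let ?w = "?vs ! i"
  obtain ys where ys: "drop i ?vs = map ((@) ?w) ?V @ ys" using subtree_word(1)[OF x i] by blast
  have "?w @ z \<in> set ?vs" using z by (rule in_set_takeD)
  then have "z \<in> set ?V" using subtree_word(2)[OF x i] by blast
  then obtain q where q: "q < length ?V" "z = ?V ! q" by (auto simp: in_set_conv_nth)
  obtain p where p: "p < length ?vs" "p < h" "?w @ z = ?vs ! p"
    using z by (auto simp: in_set_conv_nth)
  have "drop i ?vs ! q = ?w @ z" unfolding ys using q by (simp add: nth_append)
  moreover have "i + q < length ?vs"
    using arg_cong[OF ys, of length] q by simp
  ultimately have "?vs ! (i + q) = ?vs ! p" using p by simp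
  then have "i + q = p"
    using \<open>i + q < length ?vs\<close> p(1) distinct_visit[OF separated_root] by (simp add: nth_eq_iff_index_eq)
  then have "q < h" using p by simp
  then show ?thesis using q by (auto simp: in_set_conv_nth)
qed

lemma sum_over_visited:
  assumes x: "x \<in> tree_words n"
  shows "(\<Sum>w\<in>set (visit [[]] x). g w) = (\<Sum>i<n. g (visit [[]] x ! i))"
proof -
  have "bij_betw ((!) (visit [[]] x)) {..<n} (set (visit [[]] x))"
    using length_visit_tree_word[OF x] distinct_visit[OF separated_root] by (intro bij_betw_nth) auto
  then show ?thesis by (rule sum.reindex_bij_betw[symmetric])
qed

lemma below_eq_card: "distinct us \<Longrightarrow> below r us = card {u \<in> set us. length u < r}"
  unfolding below_def by (metis distinct_card distinct_filter set_filter)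

text \<open>\<open>burnable_lower\<close> is applied with \<open>H\<close> the first
  \<open>h\<close> visited vertices. The descendants of a vertex within \<open>H\<close> are among
  the first \<open>h\<close> vertices of its subtree, so \<open>h\<close> letters of each rotation
  suffice.\<close>

lemma few_rounds:
  assumes x: "x \<in> tree_words n" and h: "h \<le> n"
    and b: "tree_burning_number (set (visit [[]] x)) \<le> k"
  shows "(real h)\<^sup>2 / 4 \<le> (\<Sum>i<n. (real (below (3 * k) (visit [[]] (take h (rotate i x)))))\<^sup>2)"
proof -
  let ?vs = "visit [[]] x"
  let ?T = "set ?vs" and ?H = "set (take h ?vs)"
  let ?b = "tree_burning_number ?T"
  have dist: "distinct (visit [[]] y)" for y by (rule distinct_visit) simp
  have "card ?H = h"
    using h length_visit_tree_word[OF x] dist[of x] by (simp add: distinct_card)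
  then have "(real h)\<^sup>2 \<le> 4 * (\<Sum>w\<in>?T. (real (card {u \<in> ?H. \<exists>z. u = w @ z \<and> length z < 3 * ?b}))\<^sup>2)"
    using burnable_lower[of ?T ?H ?b] rooted_tree_word[OF x] burnable_tree_burning_number[of ?T]
    by (metis List.finite_set set_take_subset)
  also have "(\<Sum>w\<in>?T. (real (card {u \<in> ?H. \<exists>z. u = w @ z \<and> length z < 3 * ?b}))\<^sup>2) =
      (\<Sum>i<n. (real (card {u \<in> ?H. \<exists>z. u = ?vs ! i @ z \<and> length z < 3 * ?b}))\<^sup>2)"
    by (rule sum_over_visited[OF x])
  also have "\<dots> \<le> (\<Sum>i<n. (real (below (3 * k) (visit [[]] (take h (rotate i x)))))\<^sup>2)"
  proof (intro sum_mono power_mono of_nat_mono)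
    fix i assume i: "i \<in> {..<n}"
    let ?w = "?vs ! i" and ?V = "take h (visit [[]] (rotate i x))"
    have "{u \<in> ?H. \<exists>z. u = ?w @ z \<and> length z < 3 * ?b} \<subseteq> (@) ?w ` {z \<in> set ?V. length z < 3 * k}"
    proof
      fix u assume "u \<in> {u \<in> ?H. \<exists>z. u = ?w @ z \<and> length z < 3 * ?b}"
      then obtain z where z: "u = ?w @ z" "u \<in> ?H" "length z < 3 * ?b" by blast
      then have "z \<in> set ?V" using subtree_take[OF x, of i z h] i by simp
      then show "u \<in> (@) ?w ` {z \<in> set ?V. length z < 3 * k}" using z b by auto
    qed
    then have "card {u \<in> ?H. \<exists>z. u = ?w @ z \<and> length z < 3 * ?b} \<le>
        card ((@) ?w ` {z \<in> set ?V. length z < 3 * k})"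
      by (intro card_mono) auto
    also have "\<dots> \<le> card {z \<in> set ?V. length z < 3 * k}" by (intro card_image_le) auto
    also have "\<dots> = below (3 * k) ?V" using dist by (intro below_eq_card[symmetric]) simp
    finally show "card {u \<in> ?H. \<exists>z. u = ?w @ z \<and> length z < 3 * ?b} \<le>
        below (3 * k) (visit [[]] (take h (rotate i x)))"
      by (simp only: visit_take)
  qed auto
  finally show ?thesis by simp
qed

text \<open>
  The second summand is at least \<open>1\<close> for a high subtree of more than \<open>h\<close> vertices whose first \<open>h\<close>
  vertices do not reveal its height.
\<close>

lemma many_high_subtrees:
  assumes x: "x \<in> tree_words n" and h: "0 < h"
  shows "real (card {w \<in> set (visit [[]] x). \<exists>v. length v = r \<and> w @ v \<in> set (visit [[]] x)}) \<le>
    (\<Sum>i<n. indicator {y. \<exists>u\<in>set (visit [[]] y). r \<le> length u} (take h (rotate i x)) +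
      (real (below r (visit [[]] (take h (rotate i x)))) / real h)\<^sup>2)"
proof -
  let ?vs = "visit [[]] x"
  let ?T = "set ?vs"
  let ?high = "\<lambda>w. \<exists>v. length v = r \<and> w @ v \<in> ?T"
  let ?reach = "{y. \<exists>u\<in>set (visit [[]] y). r \<le> length u}"
  have "real (card {w \<in> ?T. ?high w}) = (\<Sum>w\<in>?T. indicator {w. ?high w} w)"
    by (simp add: indicator_def of_bool_def sum.If_cases Int_def)
  also have "\<dots> = (\<Sum>i<n. indicator {w. ?high w} (?vs ! i))" by (rule sum_over_visited[OF x])
  also have "\<dots> \<le> (\<Sum>i<n. indicator ?reach (take h (rotate i x)) +
      (real (below r (visit [[]] (take h (rotate i x)))) / real h)\<^sup>2)"
  proof (rule sum_mono)
    fix i assume i: "i \<in> {..<n}"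
    let ?V = "visit [[]] (rotate i x)"
    show "indicator {w. ?high w} (?vs ! i) \<le>
        indicator ?reach (take h (rotate i x)) + (real (below r (visit [[]] (take h (rotate i x)))) / real h)\<^sup>2"
    proof (cases "?high (?vs ! i) \<and> take h (rotate i x) \<notin> ?reach")
      case False
      then show ?thesis by (auto simp: indicator_def)
    next
      case True
      then obtain v where v: "length v = r" "?vs ! i @ v \<in> ?T" by blast
      then have "v \<in> set ?V" using subtree_word(2)[OF x, of i] i by blast
      have all: "\<forall>u\<in>set (take h ?V). length u < r" using True by (auto simp: visit_take not_le)
      with v(1) have "v \<notin> set (take h ?V)" by blast
      with \<open>v \<in> set ?V\<close> have "h < length ?V" by (metis not_le take_all)
      moreover have "filter (\<lambda>u. length u < r) (take h ?V) = take h ?V" using all by (simp add: filter_id_conv)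
      ultimately have "below r (visit [[]] (take h (rotate i x))) = h"
        by (simp add: below_def visit_take)
      then show ?thesis using h by (simp add: indicator_def)
    qed
  qed
  finally show ?thesis .
qed

section \<open>Removing the conditioning on the size\<close>

context critical_offspring
begin

text \<open>The joint probability of size \<open>n\<close> and \<open>Q\<close>; conditional
  probabilities appear as quotients.\<close>

definition tree_prob :: "nat \<Rightarrow> (nat list set \<Rightarrow> bool) \<Rightarrow> real" where
  "tree_prob n Q = measure_pmf.prob (replicate_pmf n \<xi>) {x \<in> tree_words n. Q (set (visit [[]] x))}"

lemma tree_prob_cond:
  "\<P>(X in offspring_space \<xi>. Q (gw_tree X) \<bar> has_size (gw_tree X) n) = tree_prob n Q / tree_prob n (\<lambda>_. True)"
  using prob_tree[of \<xi> n Q] prob_tree[of \<xi> n "\<lambda>_. True"]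
  by (simp add: cond_prob_def tree_prob_def conj_commute)

text \<open>The Otter-Dwass formula, obtained from \<open>nn_integral_rotations\<close> with
  \<open>F = 1\<close>.\<close>

lemma tree_prob_size:
  "real n * tree_prob n (\<lambda>_. True) = measure_pmf.prob (replicate_pmf n \<xi>) {x. 1 + sum_list x = n}"
proof -
  let ?R = "replicate_pmf n \<xi>"
  have "(\<integral>\<^sup>+x. indicator (tree_words n) x * (\<Sum>i<n. 1) \<partial>?R) = (\<integral>\<^sup>+x. indicator {x. 1 + sum_list x = n} x * 1 \<partial>?R)"
    by (rule nn_integral_rotations)
  then have "emeasure ?R (tree_words n) * of_nat n = emeasure ?R {x. 1 + sum_list x = n}"
    by (simp add: nn_integral_multc)
  then show ?thesis
    by (simp add: tree_prob_def measure_pmf.emeasure_eq_measure ennreal_of_nat_eq_real_of_nat mult.commute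
        flip: ennreal_mult')
qed

text \<open>Markov's inequality for the sum over rotations, which
  \<open>nn_integral_rotations\<close> turns into an integral over words of sum
  \<open>n - 1\<close>. Given the first \<open>h\<close> letters, the other \<open>n - h\<close>
  must have a prescribed sum, at a cost of at most \<open>C / sqrt (n - h)\<close>.\<close>

lemma tree_prob_markov:
  assumes C: "\<And>m j. 0 < m \<Longrightarrow> measure_pmf.prob (replicate_pmf m \<xi>) {x. sum_list x = j} \<le> C / sqrt (real m)"
    and h: "h < n" and f: "\<And>x. 0 \<le> f x" and L: "0 \<le> L" and e: "0 \<le> e"
    and Q: "\<And>x. x \<in> tree_words n \<Longrightarrow> Q (set (visit [[]] x)) \<Longrightarrow> L \<le> (\<Sum>i<n. f (take h (rotate i x)))"
    and fe: "(\<integral>\<^sup>+x. ennreal (f x) \<partial>replicate_pmf h \<xi>) \<le> ennreal e"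
  shows "tree_prob n Q * L \<le> C / sqrt (real (n - h)) * e"
proof -
  let ?R = "\<lambda>n. measure_pmf (replicate_pmf n \<xi>)"
  let ?A = "{x \<in> tree_words n. Q (set (visit [[]] x))}"
  have C0: "0 \<le> C / sqrt (real (n - h))"
    using C[of "n - h" 0] h measure_nonneg[of "?R (n - h)"] by (meson order_trans zero_less_diff)
  have "ennreal (tree_prob n Q * L) = (\<integral>\<^sup>+x. ennreal L * indicator ?A x \<partial>?R n)"
    using L by (simp add: nn_integral_cmult tree_prob_def measure_pmf.emeasure_eq_measure ennreal_mult' mult.commute)
  also have "\<dots> \<le> (\<integral>\<^sup>+x. indicator (tree_words n) x * (\<Sum>i<n. ennreal (f (take h (rotate i x)))) \<partial>?R n)"
    using Q f by (intro nn_integral_mono) (auto simp: indicator_def sum_ennreal intro: ennreal_leI)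
  also have "\<dots> = (\<integral>\<^sup>+y. indicator {y. 1 + sum_list y = n} y * ennreal (f (take h y)) \<partial>?R n)"
    by (rule nn_integral_rotations)
  also have "\<dots> = (\<integral>\<^sup>+y. indicator {y. 1 + sum_list y = n} y * ennreal (f (take h y)) \<partial>?R (h + (n - h)))"
    using h by simp
  also have "\<dots> = (\<integral>\<^sup>+xs. \<integral>\<^sup>+ys. indicator {y. 1 + sum_list y = n} (xs @ ys) * ennreal (f (take h (xs @ ys)))
      \<partial>?R (n - h) \<partial>?R h)"
    unfolding replicate_pmf_distrib by simp
  also have "\<dots> \<le> (\<integral>\<^sup>+xs. ennreal (C / sqrt (real (n - h))) * ennreal (f xs) \<partial>?R h)"
  proof (rule nn_integral_mono_AE, rule AE_pmfI)
    fix xs assume "xs \<in> set_pmf (replicate_pmf h \<xi>)"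
    then have len: "length xs = h" by (rule length_replicate_pmf)
    have "(\<integral>\<^sup>+ys. indicator {y. 1 + sum_list y = n} (xs @ ys) * ennreal (f (take h (xs @ ys))) \<partial>?R (n - h)) =
        (\<integral>\<^sup>+ys. indicator {ys. 1 + sum_list (xs @ ys) = n} ys * ennreal (f xs) \<partial>?R (n - h))"
      using len by (intro nn_integral_cong) (simp add: indicator_def)
    also have "\<dots> = emeasure (?R (n - h)) {ys. 1 + sum_list (xs @ ys) = n} * ennreal (f xs)"
      by (simp add: nn_integral_multc)
    \<comment> \<open>Truncated subtraction is harmless: if \<open>xs\<close> already exceeds the
      total, the event on the left is empty.\<close>
    also have "\<dots> \<le> emeasure (?R (n - h)) {ys. sum_list ys = n - 1 - sum_list xs} * ennreal (f xs)"
      by (intro mult_right_mono emeasure_mono) auto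
    also have "\<dots> \<le> ennreal (C / sqrt (real (n - h))) * ennreal (f xs)"
      using C[of "n - h" "n - 1 - sum_list xs"] h
      by (intro mult_right_mono) (auto simp: measure_pmf.emeasure_eq_measure intro!: ennreal_leI)
    finally show "(\<integral>\<^sup>+ys. indicator {y. 1 + sum_list y = n} (xs @ ys) * ennreal (f (take h (xs @ ys))) \<partial>?R (n - h))
        \<le> ennreal (C / sqrt (real (n - h))) * ennreal (f xs)" .
  qed
  also have "\<dots> = ennreal (C / sqrt (real (n - h))) * (\<integral>\<^sup>+xs. ennreal (f xs) \<partial>?R h)"
    by (rule nn_integral_cmult) simp
  also have "\<dots> \<le> ennreal (C / sqrt (real (n - h))) * ennreal e"
    using fe by (intro mult_left_mono) auto
  finally have "ennreal (tree_prob n Q * L) \<le> ennreal (C / sqrt (real (n - h)) * e)"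
    unfolding ennreal_mult[OF C0 e] .
  then show ?thesis using C0 e by (simp only: ennreal_le_iff mult_nonneg_nonneg)
qed

text \<open>
  Since \<open>f\<close> only reads the first half of the word, the local limit bounds make conditioning on the
  sum of the whole word cost no more than a constant factor.
\<close>

lemma cond_markov:
  "\<exists>K>0. \<exists>N\<ge>2. \<forall>n\<ge>N. 0 < tree_prob n (\<lambda>_. True) \<longrightarrow> (\<forall>Q f L e.
     (\<forall>x. 0 \<le> f x) \<longrightarrow> (0::real) < L \<longrightarrow> 0 \<le> e \<longrightarrow>
     (\<forall>x\<in>tree_words n. Q (set (visit [[]] x)) \<longrightarrow> L \<le> (\<Sum>i<n. f (take (n div 2) (rotate i x)))) \<longrightarrow>
     (\<integral>\<^sup>+x. ennreal (f x) \<partial>replicate_pmf (n div 2) \<xi>) \<le> ennreal e \<longrightarrow>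
     tree_prob n Q / tree_prob n (\<lambda>_. True) \<le> K * real n * e / L)"
proof -
  obtain C where C: "0 < C"
    "\<And>m j. 0 < m \<Longrightarrow> measure_pmf.prob (replicate_pmf m \<xi>) {x. sum_list x = j} \<le> C / sqrt (real m)"
    using local_upper_bound by blast
  obtain c N where c: "0 < c" "\<And>n. N \<le> n \<Longrightarrow> period dvd n - 1 \<Longrightarrow>
     c / sqrt (real n) \<le> measure_pmf.prob (replicate_pmf n \<xi>) {x. 1 + sum_list x = n}"
    using local_lower_bound unfolding eventually_sequentially by blast
  define K where "K = 2 * C / c"
  have "tree_prob n Q / tree_prob n (\<lambda>_. True) \<le> K * real n * e / L"
    if n: "max N 2 \<le> n" and pos: "0 < tree_prob n (\<lambda>_. True)" and f: "\<forall>x. 0 \<le> f x" and L: "0 < L" and e: "0 \<le> e"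
      and Q: "\<forall>x\<in>tree_words n. Q (set (visit [[]] x)) \<longrightarrow> L \<le> (\<Sum>i<n. f (take (n div 2) (rotate i x)))"
      and fe: "(\<integral>\<^sup>+x. ennreal (f x) \<partial>replicate_pmf (n div 2) \<xi>) \<le> ennreal e" for n Q f L e
  proof -
    let ?t = "tree_prob n (\<lambda>_. True)"
    have n0: "0 < n" "n div 2 < n" using n by auto
    \<comment> \<open>A positive size probability provides a word of sum \<open>n - 1\<close>, which
      places \<open>n\<close> in the residue class required by the local lower bound.\<close>
    have "0 < measure_pmf.prob (replicate_pmf n \<xi>) {x. 1 + sum_list x = n}"
      unfolding tree_prob_size[symmetric] using pos n0 by simp
    then obtain x where "x \<in> set_pmf (replicate_pmf n \<xi>)" "1 + sum_list x = n"
      by (metis (mono_tags, lifting) disjoint_iff less_irrefl measure_pmf_zero_iff mem_Collect_eq)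
    then have "period dvd n - 1" using period_dvd_sum_list by fastforce
    with c(2) n have "c / sqrt n \<le> n * ?t" unfolding tree_prob_size by simp
    then have t: "c \<le> n * ?t * sqrt n" using n0 by (simp add: pos_divide_le_eq)
    have "real n \<le> 4 * real (n - n div 2)" by linarith
    then have "sqrt n \<le> sqrt (4 * real (n - n div 2))" by (rule real_sqrt_le_mono)
    then have s: "sqrt n \<le> 2 * sqrt (n - n div 2)" by (simp only: real_sqrt_mult real_sqrt_four)
    have s0: "0 < sqrt (n - n div 2)" "0 < sqrt n" using n0 by auto
    have "tree_prob n Q * L \<le> C / sqrt (real (n - n div 2)) * e"
      using Q f L e fe n0 by (intro tree_prob_markov[OF C(2)]) auto
    also have "\<dots> \<le> 2 * C / sqrt n * e"
    proof (rule mult_right_mono[OF _ e])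
      have "C * sqrt n \<le> C * (2 * sqrt (n - n div 2))" using s C(1) by (intro mult_left_mono) auto
      then show "C / sqrt (real (n - n div 2)) \<le> 2 * C / sqrt n"
        using s0 by (simp add: field_simps)
    qed
    also have "\<dots> = (2 * C * e / (c * sqrt n)) * c" using c by simp
    also have "\<dots> \<le> (2 * C * e / (c * sqrt n)) * (n * ?t * sqrt n)"
      using t C(1) c(1) e by (intro mult_left_mono) auto
    also have "\<dots> = K * n * e * ?t" using s0 by (simp add: K_def)
    finally show ?thesis using L pos by (simp add: field_simps)
  qed
  moreover have "0 < K" using C c by (simp add: K_def)
  ultimately show ?thesis by (intro exI[of _ K] conjI exI[of _ "max N 2"]) auto
qed

section \<open>Tail bounds for the burning number\<close>

lemma lower_event:
  "\<exists>K>0. \<exists>N. \<forall>n\<ge>N. 0 < tree_prob n (\<lambda>_. True) \<longrightarrow> (\<forall>\<kappa>\<ge>0.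
     tree_prob n (\<lambda>T. \<not> \<kappa> \<le> real (tree_burning_number T)) / tree_prob n (\<lambda>_. True) \<le> K * \<kappa> ^ 3 / real n)"
proof -
  obtain K N where K: "0 < K" "2 \<le> N"
    "\<And>n Q f L e. N \<le> n \<Longrightarrow> 0 < tree_prob n (\<lambda>_. True) \<Longrightarrow> (\<And>x. 0 \<le> f x) \<Longrightarrow> 0 < L \<Longrightarrow> 0 \<le> e \<Longrightarrow>
       (\<And>x. x \<in> tree_words n \<Longrightarrow> Q (set (visit [[]] x)) \<Longrightarrow> L \<le> (\<Sum>i<n. f (take (n div 2) (rotate i x)))) \<Longrightarrow>
       (\<integral>\<^sup>+x. ennreal (f x) \<partial>replicate_pmf (n div 2) \<xi>) \<le> ennreal e \<Longrightarrow>
       tree_prob n Q / tree_prob n (\<lambda>_. True) \<le> K * real n * e / L"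
    using cond_markov by metis
  \<comment> \<open>The factor \<open>27\<close> comes from the cube of \<open>3 * k\<close>, and
    \<open>36\<close> from the \<open>4\<close> in \<open>few_rounds\<close> together with
    \<open>n \<le> 3 * h\<close> squared.\<close>
  define K' where "K' = K * (1 + sigma2) * 27 * 36"
  have K': "0 < K'" using K(1) variance_pos unfolding K'_def by (intro mult_pos_pos add_pos_pos) auto
  have "tree_prob n (\<lambda>T. \<not> \<kappa> \<le> real (tree_burning_number T)) / tree_prob n (\<lambda>_. True) \<le> K' * \<kappa> ^ 3 / real n"
    if n: "N \<le> n" and pos: "0 < tree_prob n (\<lambda>_. True)" and \<kappa>: "0 \<le> \<kappa>" for n \<kappa>
  proof -
    define h where "h = n div 2"
    define k where "k = nat \<lfloor>\<kappa>\<rfloor>"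
    define e where "e = (1 + sigma2) * real (3 * k) ^ 3"
    have "n \<le> 3 * h" using n K(2) unfolding h_def by linarith
    then have h: "real n \<le> 3 * real h" "0 < h" using n K(2) by (auto simp: h_def)
    have k: "real k \<le> \<kappa>" using \<kappa> by (simp add: k_def)
    have e0: "0 \<le> e" using variance_pos unfolding e_def by (intro mult_nonneg_nonneg add_nonneg_nonneg) auto
    have "tree_prob n (\<lambda>T. \<not> \<kappa> \<le> real (tree_burning_number T)) / tree_prob n (\<lambda>_. True) \<le>
        K * real n * e / ((real h)\<^sup>2 / 4)"
    proof (rule K(3)[where f = "\<lambda>x. (real (below (3 * k) (visit [[]] x)))\<^sup>2"])
      fix x assume x: "x \<in> tree_words n" "\<not> \<kappa> \<le> real (tree_burning_number (set (visit [[]] x)))"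
      then have "tree_burning_number (set (visit [[]] x)) \<le> k"
        unfolding k_def using \<kappa> by linarith
      then show "(real h)\<^sup>2 / 4 \<le> (\<Sum>i<n. (real (below (3 * k) (visit [[]] (take (n div 2) (rotate i x)))))\<^sup>2)"
        using few_rounds[OF x(1), of h k] by (simp add: h_def)
    next
      show "(\<integral>\<^sup>+x. ennreal ((real (below (3 * k) (visit [[]] x)))\<^sup>2) \<partial>replicate_pmf (n div 2) \<xi>) \<le> ennreal e"
        unfolding e_def by (rule second_moment_below)
    qed (use n pos h e0 in auto)
    also have "\<dots> \<le> K * real n * ((1 + sigma2) * 27 * \<kappa> ^ 3) / ((real n)\<^sup>2 / 36)"
    proof (rule frac_le)
      have "real k ^ 3 \<le> \<kappa> ^ 3" using k by (intro power_mono) auto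
      then have "(1 + sigma2) * 27 * real k ^ 3 \<le> (1 + sigma2) * 27 * \<kappa> ^ 3"
        using variance_pos by (intro mult_left_mono) auto
      then have "e \<le> (1 + sigma2) * 27 * \<kappa> ^ 3" unfolding e_def by (simp add: power_mult_distrib algebra_simps)
      then show "K * real n * e \<le> K * real n * ((1 + sigma2) * 27 * \<kappa> ^ 3)"
        using K(1) by (intro mult_left_mono) auto
      have "(real n)\<^sup>2 \<le> (3 * real h)\<^sup>2" using h(1) by (intro power_mono) auto
      then show "(real n)\<^sup>2 / 36 \<le> (real h)\<^sup>2 / 4" by (simp add: power_mult_distrib)
      show "0 \<le> K * real n * ((1 + sigma2) * 27 * \<kappa> ^ 3)"
        using K(1) variance_pos \<kappa> by (intro mult_nonneg_nonneg add_nonneg_nonneg) auto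
      show "0 < (real n)\<^sup>2 / 36" using n K(2) by simp
    qed
    also have "\<dots> = K' * \<kappa> ^ 3 / real n" by (simp add: K'_def power2_eq_square)
    finally show ?thesis .
  qed
  with K' show ?thesis by blast
qed

lemma upper_event:
  "\<exists>C>0. \<exists>N. \<forall>n\<ge>N. 0 < tree_prob n (\<lambda>_. True) \<longrightarrow> (\<forall>\<kappa>\<ge>20.
     tree_prob n (\<lambda>T. \<not> real (tree_burning_number T) \<le> \<kappa>) / tree_prob n (\<lambda>_. True) \<le> C * real n / \<kappa> ^ 3)"
proof -
  obtain K N where K: "0 < K" "2 \<le> N"
    "\<And>n Q f L e. N \<le> n \<Longrightarrow> 0 < tree_prob n (\<lambda>_. True) \<Longrightarrow> (\<And>x. 0 \<le> f x) \<Longrightarrow> 0 < L \<Longrightarrow> 0 \<le> e \<Longrightarrow>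
       (\<And>x. x \<in> tree_words n \<Longrightarrow> Q (set (visit [[]] x)) \<Longrightarrow> L \<le> (\<Sum>i<n. f (take (n div 2) (rotate i x)))) \<Longrightarrow>
       (\<integral>\<^sup>+x. ennreal (f x) \<partial>replicate_pmf (n div 2) \<xi>) \<le> ennreal e \<Longrightarrow>
       tree_prob n Q / tree_prob n (\<lambda>_. True) \<le> K * real n * e / L"
    using cond_markov by metis
  \<comment> \<open>The constants come from \<open>r \<le> 3 / 2 * sqrt n\<close> raised to the
    fourth power and from \<open>n \<le> 3 * h\<close> squared. The \<open>100\<close> in
    \<open>C\<close> is \<open>5 * 20\<close>, from \<open>\<kappa> / 5 \<le> r\<close> and
    \<open>\<kappa>\<^sup>2 / 20 \<le> L\<close>.\<close>
  define A where "A = 1 / branch_prob + (1 + sigma2) * 9 * (81 / 16)"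
  have A: "0 < A"
    using branch_prob_bounds variance_pos unfolding A_def by (intro add_pos_pos mult_pos_pos) auto
  define C where "C = K * A * 100"
  have "tree_prob n (\<lambda>T. \<not> real (tree_burning_number T) \<le> \<kappa>) / tree_prob n (\<lambda>_. True) \<le> C * real n / \<kappa> ^ 3"
    if n: "N \<le> n" and pos: "0 < tree_prob n (\<lambda>_. True)" and \<kappa>: "20 \<le> \<kappa>" for n \<kappa>
  proof -
    have n1: "1 \<le> real n" using n K(2) by simp
    have bound: "real (tree_burning_number (set (visit [[]] x))) \<le>
        2 * real r + real (card {w \<in> set (visit [[]] x). \<exists>v. length v = r \<and> w @ v \<in> set (visit [[]] x)}) / real r + 1"
      if "x \<in> tree_words n" "0 < r" for x r
      using tree_burning_number_upper[of "set (visit [[]] x)" r] rooted_tree_word that by simp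
    show ?thesis
    \<comment> \<open>Above this threshold the event is empty: \<open>r\<close> equal to the ceiling
      of \<open>sqrt n\<close> gives at most \<open>3 * sqrt n + 3\<close> rounds. Below it,
      \<open>r\<close> is of order at most \<open>sqrt n\<close>, as the second-moment term
      requires.\<close>
    proof (cases "6 * sqrt (real n) \<le> \<kappa>")
      case True
      have "real (tree_burning_number (set (visit [[]] x))) \<le> \<kappa>" if x: "x \<in> tree_words n" for x
      proof -
        let ?N = "{w \<in> set (visit [[]] x). \<exists>v. length v = nat \<lceil>sqrt (real n)\<rceil> \<and> w @ v \<in> set (visit [[]] x)}"
        define r where "r = nat \<lceil>sqrt (real n)\<rceil>"
        have s1: "1 \<le> sqrt (real n)" using n1 by simp
        have r: "sqrt (real n) \<le> real r" "real r \<le> sqrt (real n) + 1" "0 < r"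
          using s1 unfolding r_def by linarith+
        have "card ?N \<le> n"
          using card_mono[of "set (visit [[]] x)" ?N] card_visit_tree_word[OF x] by auto
        then have "real (card ?N) / real r \<le> real n / sqrt (real n)"
          using r s1 by (intro frac_le) auto
        also have "\<dots> = sqrt (real n)" by (rule real_div_sqrt) simp
        finally have "real (card ?N) / real r \<le> sqrt (real n)" .
        with bound[OF x r(3)] r s1 True show ?thesis unfolding r_def by linarith
      qed
      then have "{x \<in> tree_words n. \<not> real (tree_burning_number (set (visit [[]] x))) \<le> \<kappa>} = {}" by blast
      then have "tree_prob n (\<lambda>T. \<not> real (tree_burning_number T) \<le> \<kappa>) = 0"
        unfolding tree_prob_def by (simp only: measure_empty)
      then show ?thesis using K(1) A \<kappa> by (simp add: C_def)
    next
      case False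
      define h where "h = n div 2"
      \<comment> \<open>The radii use up at most half of the rounds, so a failure forces at least
        \<open>r * \<kappa> / 4\<close> high subtrees. The assumption
        \<open>20 \<le> \<kappa>\<close> pays for the rounding, as
        \<open>\<kappa> / 4 - 1 \<ge> \<kappa> / 5\<close>.\<close>
      define r where "r = nat \<lfloor>\<kappa> / 4\<rfloor>"
      have "n \<le> 3 * h" using n K(2) unfolding h_def by linarith
      then have h: "real n \<le> 3 * real h" "0 < h" using n K(2) by (auto simp: h_def)
      have r: "real r \<le> \<kappa> / 4" "\<kappa> / 5 \<le> real r" "0 < r"
        using \<kappa> unfolding r_def by linarith+
      define e where "e = survival r + (1 + sigma2) * real r ^ 3 / (real h)\<^sup>2"
      define L where "L = real r * (\<kappa> / 4)"
      let ?reach = "{y. \<exists>u\<in>set (visit [[]] y). r \<le> length u}"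
      let ?f = "\<lambda>y. indicator ?reach y + (real (below r (visit [[]] y)) / real h)\<^sup>2"
      have e0: "0 \<le> e"
        using survival_bounds[of r] variance_pos unfolding e_def
        by (intro add_nonneg_nonneg divide_nonneg_nonneg mult_nonneg_nonneg) auto
      have "tree_prob n (\<lambda>T. \<not> real (tree_burning_number T) \<le> \<kappa>) / tree_prob n (\<lambda>_. True) \<le> K * real n * e / L"
      proof (rule K(3)[where f = ?f])
        fix x assume x: "x \<in> tree_words n" "\<not> real (tree_burning_number (set (visit [[]] x))) \<le> \<kappa>"
        let ?N = "{w \<in> set (visit [[]] x). \<exists>v. length v = r \<and> w @ v \<in> set (visit [[]] x)}"
        have "\<kappa> / 4 \<le> real (card ?N) / real r"
          using bound[OF x(1) r(3)] x(2) r \<kappa> by linarith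
        then have "L \<le> real (card ?N)" using r(3) by (simp add: L_def field_simps)
        also have "\<dots> \<le> (\<Sum>i<n. ?f (take h (rotate i x)))"
          using many_high_subtrees[OF x(1) h(2)] .
        finally show "L \<le> (\<Sum>i<n. ?f (take (n div 2) (rotate i x)))" unfolding h_def .
      next
        have "(\<integral>\<^sup>+y. ennreal (?f y) \<partial>replicate_pmf h \<xi>) =
            (\<integral>\<^sup>+y. indicator ?reach y \<partial>replicate_pmf h \<xi>) +
            (\<integral>\<^sup>+y. ennreal (1 / (real h)\<^sup>2) * ennreal ((real (below r (visit [[]] y)))\<^sup>2) \<partial>replicate_pmf h \<xi>)"
          by (subst nn_integral_add[symmetric])
            (auto intro!: nn_integral_cong simp: power_divide ennreal_indicator ennreal_mult'[symmetric])
        also have "(\<integral>\<^sup>+y. ennreal (1 / (real h)\<^sup>2) * ennreal ((real (below r (visit [[]] y)))\<^sup>2) \<partial>replicate_pmf h \<xi>) =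
            ennreal (1 / (real h)\<^sup>2) * (\<integral>\<^sup>+y. ennreal ((real (below r (visit [[]] y)))\<^sup>2) \<partial>replicate_pmf h \<xi>)"
          by (rule nn_integral_cmult) simp
        also have "(\<integral>\<^sup>+y. indicator ?reach y \<partial>replicate_pmf h \<xi>) + \<dots> \<le>
            ennreal (survival r) + ennreal (1 / (real h)\<^sup>2) * ennreal ((1 + sigma2) * real r ^ 3)"
          by (intro add_mono mult_left_mono reach_probability second_moment_below) simp
        also have "\<dots> = ennreal e"
        proof -
          have "0 \<le> (1 + sigma2) * real r ^ 3" "0 \<le> survival r"
            using variance_pos survival_bounds[of r] by (auto intro!: mult_nonneg_nonneg add_nonneg_nonneg)
          then show ?thesis
            by (simp only: ennreal_mult'[symmetric] ennreal_plus[symmetric] zero_le_power2 zero_le_divide_1_iff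
                mult_nonneg_nonneg e_def) simp
        qed
        finally show "(\<integral>\<^sup>+y. ennreal (?f y) \<partial>replicate_pmf (n div 2) \<xi>) \<le> ennreal e" unfolding h_def .
      qed (use n pos r \<kappa> e0 in \<open>auto simp: L_def intro!: add_nonneg_nonneg\<close>)
      also have "\<dots> \<le> K * real n * (A * 5 / \<kappa>) / (\<kappa>\<^sup>2 / 20)"
      proof (rule frac_le)
        have "survival r \<le> 1 / (branch_prob * real r)"
          unfolding survival_def using branch_prob_bounds r(3) by (intro frac_le) auto
        moreover have "real r ^ 3 / (real h)\<^sup>2 \<le> 9 * (81 / 16) / real r"
        proof -
          have "real r \<le> 3 / 2 * sqrt (real n)" using r(1) False by linarith
          then have "real r ^ 4 \<le> (3 / 2 * sqrt (real n)) ^ 4" by (intro power_mono) auto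
          also have "\<dots> = 81 / 16 * (sqrt (real n) ^ 2) ^ 2" by (simp only: power_mult_distrib power_mult[symmetric]) (simp add: power_divide)
          also have "\<dots> = 81 / 16 * (real n)\<^sup>2" by simp
          also have "\<dots> \<le> 81 / 16 * (3 * real h)\<^sup>2" using h(1) by (intro mult_left_mono power_mono) auto
          finally have "real r ^ 3 * real r \<le> 9 * (81 / 16) * (real h)\<^sup>2"
            by (simp add: power_mult_distrib power_Suc2[symmetric] del: power_Suc)
          then show ?thesis using r(3) h(2) by (simp add: field_simps)
        qed
        then have "(1 + sigma2) * (real r ^ 3 / (real h)\<^sup>2) \<le> (1 + sigma2) * (9 * (81 / 16) / real r)"
          using variance_pos by (intro mult_left_mono) auto
        ultimately have "e \<le> 1 / (branch_prob * real r) + (1 + sigma2) * (9 * (81 / 16) / real r)"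
          unfolding e_def by simp
        also have "\<dots> = A / real r" by (simp add: A_def add_divide_distrib)
        also have "\<dots> \<le> A / (\<kappa> / 5)" using A r \<kappa> by (intro divide_left_mono) auto
        finally have "e \<le> A * 5 / \<kappa>" by simp
        then show "K * real n * e \<le> K * real n * (A * 5 / \<kappa>)"
          using K(1) by (intro mult_left_mono) auto
        have "\<kappa> / 5 * (\<kappa> / 4) \<le> L" unfolding L_def using r \<kappa> by (intro mult_right_mono) auto
        then show "\<kappa>\<^sup>2 / 20 \<le> L" by (simp add: power2_eq_square)
      qed (use K(1) A \<kappa> in auto)
      also have "\<dots> = C * real n / \<kappa> ^ 3"
        by (simp add: C_def power2_eq_square power3_eq_cube mult_ac)
      finally show ?thesis .
    qed
  qed
  moreover have "0 < C" using K(1) A by (simp add: C_def)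
  ultimately show ?thesis by blast
qed

lemma tree_prob_complement:
  assumes "0 < tree_prob n (\<lambda>_. True)"
  shows "norm (1 - tree_prob n (\<lambda>T. P T \<and> Q T) / tree_prob n (\<lambda>_. True)) \<le>
    tree_prob n (\<lambda>T. \<not> P T) / tree_prob n (\<lambda>_. True) + tree_prob n (\<lambda>T. \<not> Q T) / tree_prob n (\<lambda>_. True)"
proof -
  let ?S = "\<lambda>Q. {x \<in> tree_words n. Q (set (visit [[]] x))}"
  have "tree_prob n (\<lambda>T. P T \<and> Q T) \<le> tree_prob n (\<lambda>_. True)"
    unfolding tree_prob_def by (intro measure_pmf.finite_measure_mono) auto
  moreover have "tree_prob n (\<lambda>_. True) \<le>
      tree_prob n (\<lambda>T. P T \<and> Q T) + (tree_prob n (\<lambda>T. \<not> P T) + tree_prob n (\<lambda>T. \<not> Q T))"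
  proof -
    have "tree_prob n (\<lambda>_. True) \<le> measure_pmf.prob (replicate_pmf n \<xi>)
        (?S (\<lambda>T. P T \<and> Q T) \<union> (?S (\<lambda>T. \<not> P T) \<union> ?S (\<lambda>T. \<not> Q T)))"
      unfolding tree_prob_def by (intro measure_pmf.finite_measure_mono) auto
    also have "\<dots> \<le> tree_prob n (\<lambda>T. P T \<and> Q T) + (tree_prob n (\<lambda>T. \<not> P T) + tree_prob n (\<lambda>T. \<not> Q T))"
      unfolding tree_prob_def
      by (intro order_trans[OF measure_Un_le] add_left_mono measure_Un_le) auto
    finally show ?thesis .
  qed
  moreover have "1 - tree_prob n (\<lambda>T. P T \<and> Q T) / tree_prob n (\<lambda>_. True) =
      (tree_prob n (\<lambda>_. True) - tree_prob n (\<lambda>T. P T \<and> Q T)) / tree_prob n (\<lambda>_. True)"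
    using assms by (simp add: diff_divide_distrib)
  ultimately show ?thesis
    using assms by (simp only: real_norm_def abs_of_nonneg divide_nonneg_pos diff_ge_0_iff_ge
        add_divide_distrib[symmetric]) (intro divide_right_mono, auto)
qed

end

theorem theorem1:
  fixes \<xi> :: "nat pmf" and \<epsilon> :: "nat \<Rightarrow> real"
  assumes "integrable (measure_pmf \<xi>) real"
    and "measure_pmf.expectation \<xi> real = 1"
    and "integrable (measure_pmf \<xi>) (\<lambda>k. (real k)\<^sup>2)"
    and "0 < measure_pmf.variance \<xi> real"
    and "\<forall>\<^sub>F n in gw_sizes \<xi>. 0 < \<epsilon> n"
    and "(\<epsilon> \<longlongrightarrow> 0) (gw_sizes \<xi>)"
  shows "(\<lambda>n. 1 - \<P>(X in offspring_space \<xi>.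
            (\<epsilon> n * real n) powr (1/3) \<le> real (tree_burning_number (gw_tree X)) \<and>
            real (tree_burning_number (gw_tree X)) \<le> (real n / \<epsilon> n) powr (1/3)
            \<bar> has_size (gw_tree X) n))
         \<in> O[gw_sizes \<xi>](\<epsilon>)"
proof -
  interpret critical_offspring \<xi> using assms(1-4) by unfold_locales
  obtain K N where lower: "0 < K" "\<And>n \<kappa>. N \<le> n \<Longrightarrow> 0 < tree_prob n (\<lambda>_. True) \<Longrightarrow> 0 \<le> \<kappa> \<Longrightarrow>
     tree_prob n (\<lambda>T. \<not> \<kappa> \<le> real (tree_burning_number T)) / tree_prob n (\<lambda>_. True) \<le> K * \<kappa> ^ 3 / real n"
    using lower_event by blast
  obtain C M where upper: "0 < C" "\<And>n \<kappa>. M \<le> n \<Longrightarrow> 0 < tree_prob n (\<lambda>_. True) \<Longrightarrow> 20 \<le> \<kappa> \<Longrightarrow>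
     tree_prob n (\<lambda>T. \<not> real (tree_burning_number T) \<le> \<kappa>) / tree_prob n (\<lambda>_. True) \<le> C * real n / \<kappa> ^ 3"
    using upper_event by blast
  have cube: "(x powr (1/3)) ^ 3 = x" if "0 < x" for x :: real
    using that by (simp add: powr_realpow[symmetric] powr_powr)
  have "\<forall>\<^sub>F n in sequentially. max 1 (max N M) \<le> n" by (rule eventually_ge_at_top)
  then have large: "\<forall>\<^sub>F n in gw_sizes \<xi>. max 1 (max N M) \<le> n"
    unfolding gw_sizes_def by (rule filter_leD[OF inf_le1])
  have "\<forall>\<^sub>F n in gw_sizes \<xi>. \<P>(X in offspring_space \<xi>. has_size (gw_tree X) n) > 0"
    unfolding gw_sizes_def eventually_inf_principal by simp
  moreover have "\<P>(X in offspring_space \<xi>. has_size (gw_tree X) n) = tree_prob n (\<lambda>_. True)" for n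
    using prob_tree[of \<xi> n "\<lambda>_. True"] by (simp add: tree_prob_def)
  ultimately have pos: "\<forall>\<^sub>F n in gw_sizes \<xi>. 0 < tree_prob n (\<lambda>_. True)" by simp
  \<comment> \<open>With \<open>1 \<le> n\<close> this puts the upper threshold at \<open>20\<close>
    or more, the range covered by \<open>upper_event\<close>.\<close>
  have small: "\<forall>\<^sub>F n in gw_sizes \<xi>. \<epsilon> n < 1 / 20 ^ 3"
    using assms(6) by (rule order_tendstoD(2)) simp
  show ?thesis
  proof (rule bigoI)
    show "\<forall>\<^sub>F n in gw_sizes \<xi>. norm (1 - \<P>(X in offspring_space \<xi>.
            (\<epsilon> n * real n) powr (1/3) \<le> real (tree_burning_number (gw_tree X)) \<and>
            real (tree_burning_number (gw_tree X)) \<le> (real n / \<epsilon> n) powr (1/3)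
            \<bar> has_size (gw_tree X) n)) \<le> (K + C) * norm (\<epsilon> n)"
      using large pos small assms(5)
    proof eventually_elim
      case (elim n)
      let ?\<kappa> = "(\<epsilon> n * real n) powr (1/3)" and ?\<mu> = "(real n / \<epsilon> n) powr (1/3)"
      have n: "N \<le> n" "M \<le> n" "1 \<le> real n" using elim(1) by auto
      have "20 ^ 3 \<le> real n / \<epsilon> n"
      proof -
        have "20 ^ 3 * \<epsilon> n \<le> real n" using elim(3) n(3) by simp
        then show ?thesis using elim(4) by (simp only: pos_le_divide_eq)
      qed
      then have "20 ^ 3 \<le> ?\<mu> ^ 3" using n elim(4) by (subst cube) auto
      then have \<mu>: "20 \<le> ?\<mu>" by (subst (asm) power_mono_iff) auto
      have "norm (1 - tree_prob n (\<lambda>T. ?\<kappa> \<le> real (tree_burning_number T) \<and> real (tree_burning_number T) \<le> ?\<mu>)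
          / tree_prob n (\<lambda>_. True)) \<le> K * ?\<kappa> ^ 3 / real n + C * real n / ?\<mu> ^ 3"
        using lower(2)[OF n(1) elim(2), of ?\<kappa>] upper(2)[OF n(2) elim(2) \<mu>]
        by (intro order_trans[OF tree_prob_complement[OF elim(2)] add_mono]) auto
      also have "\<dots> = (K + C) * norm (\<epsilon> n)"
        using n elim(4) by (simp add: cube field_simps)
      finally show ?case
        using tree_prob_cond[where n=n and Q="\<lambda>T. ?\<kappa> \<le> real (tree_burning_number T) \<and> real (tree_burning_number T) \<le> ?\<mu>"]
        by simp
    qed
  qed
qed

end
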